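(* Let $n_1,\ldots,n_t$ be positive integers, let $t_e$ and $t_o$ be respectively the number of even and odd integers in the sequence $(n_1,\ldots,n_t)$, and let $f=82\times 35^{2^{t_o}-2}\times 81^{t_e}$. Let $c=\min\{95412,f\}$ if $t=2$ and $c=f$ otherwise. Let $n=\max\{n_1,\ldots,n_t\}$ and $N=cn$, and suppose that for each $1\leq i\leq t$ we have $n_i\geq 2\lceil \log N \rceil+2$. Let $d=d(c)$ be a non-negative real number such that $\varphi(a,c,d)\leq 0$ for every real number $a$ with $0\leq a\leq 1$. Then for sufficiently large $N$ we have $$\hat{R}(C_{n_1},\ldots,C_{n_t})\leq Nd/2.$$
   Context: Let $g(x)=x\ln x$ (with $g(0)=0$) and $$\varphi(a,c,d) = g(c)+g(d)+g((c-2)d)+\tfrac{1}{2}g((c-1-a)d)-g(c-2)-g(ad)-g((c-2-a)d)-\tfrac{1}{2}g((1-a)d)-\tfrac{1}{2}g(cd).$$ $C_k$ denotes the cycle on $k$ vertices. For graphs $G_1,\ldots,G_k$, the size-Ramsey number $\hat{R}(G_1,\ldots,G_k)$ is the smallest integer $m$ for which there exists a graph $H$ with $m$ edges such that for every coloring of the edges of $H$ with colors $1,\ldots,k$ there is, for some $i$, a copy of $G_i$ in $H$ all of whose edges have color $i$. $\log$ denotes the logarithm to base $2$ and $\ln$ the natural logarithm. (The bound is realized by random $d$-regular graphs on $N$ vertices, so $d$ is implicitly an integer with $Nd$ even.) *)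

theory Defs
  imports Complex_Main
begin

definition g :: "real \<Rightarrow> real" where
  "g x = (if x = 0 then 0 else x * ln x)"

definition phi :: "real \<Rightarrow> real \<Rightarrow> real \<Rightarrow> real" where
  "phi a c d = g c + g d + g ((c - 2) * d) + g ((c - 1 - a) * d) / 2 - g (c - 2) - g (a * d)
     - g ((c - 2 - a) * d) - g ((1 - a) * d) / 2 - g (c * d) / 2"

definition simple_graph :: "nat set set \<Rightarrow> bool" where
  "simple_graph E \<longleftrightarrow> finite E \<and> (\<forall>e\<in>E. card e = 2)"

definition has_mono_cycle :: "nat set set \<Rightarrow> (nat set \<Rightarrow> nat) \<Rightarrow> nat \<Rightarrow> nat \<Rightarrow> bool" where
  "has_mono_cycle E col i k \<longleftrightarrow>
     (\<exists>vs :: nat list. length vs = k \<and> distinct vs \<and>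
        (\<forall>j<k. {vs ! j, vs ! ((j + 1) mod k)} \<in> E \<and> col {vs ! j, vs ! ((j + 1) mod k)} = i))"

definition size_ramsey_cycles :: "nat list \<Rightarrow> nat" where
  "size_ramsey_cycles ks = (LEAST m. \<exists>E. simple_graph E \<and> card E = m \<and>
      (\<forall>col :: nat set \<Rightarrow> nat. (\<forall>e\<in>E. col e < length ks) \<longrightarrow>
         (\<exists>i<length ks. has_mono_cycle E col i (ks ! i))))"

definition f_const :: "nat \<Rightarrow> nat \<Rightarrow> real" where
  "f_const te to = 82 * 35 powr (2 ^ to - 2) * 81 ^ te"

definition c_const :: "nat \<Rightarrow> nat \<Rightarrow> real" where
  "c_const t te = (if t = 2 then min 95412 (f_const te (t - te)) else f_const te (t - te))"

end

theory Submission
  imports Defs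
begin

text \<open>
The host graph is not a random regular one. Taking \<open>a = 1\<close> in the hypothesis on \<open>phi\<close> gives
\<open>d \<ge> (2/3) (c - 3) (ln (c - 2) + 1)\<close>. If the Ramsey argument works with a ratio
\<open>c' \<le> 0.53 c\<close> in place of \<open>c\<close>, then \<open>N d / 2\<close> edges are more than enough for a greedily
chosen graph on \<open>c' n\<close> vertices in which any two disjoint \<open>n\<close>-sets are joined by an edge:
each new edge is chosen to hit the largest number of pairs not yet hit.

For a single colour, if a large vertex set has no two disjoint \<open>m\<close>-subsets without an edge between
them, then it contains two disjoint expanding pieces. Binary trees of logarithmic depth grown in these
have \<open>m\<close> leaves each, so two leaves are adjacent. A path of prescribed length between the roots, found by
depth-first search, closes up to a cycle of exactly the required length. An even cycle can be found between two sides
of a bipartite graph, so the even colours are removed one at a time from a pair of sets.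

The odd colours are treated by induction on their number. Let \<open>E\<close> be one of them. Every large set
contains, by induction, a pair \<open>(X, Y)\<close> that is free of the other colours and hence, in
colour \<open>E\<close>, has an edge between any two \<open>m\<close>-subsets. If many vertices had an \<open>E\<close>-neighbour in a suitable
part \<open>B\<close> of \<open>X\<close>, a second such pair among these would close an odd cycle through \<open>X\<close> and \<open>Y\<close>.
So few vertices have \<open>E\<close>-neighbours in \<open>B\<close>. Deleting them and repeating gives many sets \<open>B\<close>
with no \<open>E\<close>-edges between different ones, and the induction hypothesis is applied once more to their union.
\<close>

section \<open>Joined pairs, expansion and trees\<close>

text \<open>Disjointness is asked of \<open>X\<close> and \<open>Y\<close> rather than of
  \<open>A\<close> and \<open>B\<close>, so that \<open>joined E m W W\<close> describes a single
  set and one notion serves both odd and even cycles.\<close>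

definition joined :: "('a \<Rightarrow> 'a \<Rightarrow> bool) \<Rightarrow> nat \<Rightarrow> 'a set \<Rightarrow> 'a set \<Rightarrow> bool" where
  "joined E m A B \<longleftrightarrow> (\<forall>X\<subseteq>A. \<forall>Y\<subseteq>B. card X = m \<longrightarrow> card Y = m \<longrightarrow> X \<inter> Y = {} \<longrightarrow>
     (\<exists>x\<in>X. \<exists>y\<in>Y. E x y))"

definition cyc :: "('a \<Rightarrow> 'a \<Rightarrow> bool) \<Rightarrow> nat \<Rightarrow> bool" where
  "cyc E l \<longleftrightarrow> (\<exists>vs. length vs = l \<and> vs \<noteq> [] \<and> distinct vs \<and> successively E vs \<and> E (last vs) (hd vs))"

definition path :: "('a \<Rightarrow> 'a \<Rightarrow> bool) \<Rightarrow> 'a \<Rightarrow> 'a list \<Rightarrow> 'a \<Rightarrow> bool" where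
  "path E x p y \<longleftrightarrow> p \<noteq> [] \<and> hd p = x \<and> last p = y \<and> distinct p \<and> successively E p"

definition nbrs :: "('a \<Rightarrow> 'a \<Rightarrow> bool) \<Rightarrow> 'a set \<Rightarrow> 'a set \<Rightarrow> 'a set" where
  "nbrs E X B = {b\<in>B. \<exists>x\<in>X. E x b}"

text \<open>The factor 3 pays for doubling: when a tree level \<open>Y\<close> is extended, fewer
  than \<open>card Y\<close> of its neighbours lie on earlier levels, so at least
  \<open>2 * card Y\<close> are new. The bound \<open>2 * m\<close> lets levels grow up to size
  \<open>4 * m\<close>.\<close>

definition expands :: "('a \<Rightarrow> 'a \<Rightarrow> bool) \<Rightarrow> nat \<Rightarrow> 'a set \<Rightarrow> bool" where
  "expands E m Z \<longleftrightarrow> (\<forall>Y\<subseteq>Z. card Y \<le> 2 * m \<longrightarrow> 3 * card Y \<le> card (nbrs E Y (Z - Y)))"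

definition cross :: "('a \<Rightarrow> 'a \<Rightarrow> bool) \<Rightarrow> 'a set \<Rightarrow> 'a set \<Rightarrow> 'a \<Rightarrow> 'a \<Rightarrow> bool" where
  "cross E A B x y \<longleftrightarrow> E x y \<and> (x \<in> A \<and> y \<in> B \<or> x \<in> B \<and> y \<in> A)"

lemma joined_mono: "joined E m A B \<Longrightarrow> A' \<subseteq> A \<Longrightarrow> B' \<subseteq> B \<Longrightarrow> joined E m A' B'"
  unfolding joined_def by (metis order_trans)

lemma joined_sym:
  assumes "joined E m A B" "symp E"
  shows "joined E m B A"
  unfolding joined_def
proof (intro allI impI)
  fix X Y assume "X \<subseteq> B" "Y \<subseteq> A" "card X = m" "card Y = m" "X \<inter> Y = {}"
  then have "\<exists>y\<in>Y. \<exists>x\<in>X. E y x"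
    using assms(1) unfolding joined_def by (metis Int_commute)
  then show "\<exists>x\<in>X. \<exists>y\<in>Y. E x y" using assms(2) by (meson sympD)
qed

lemma joined_edge:
  assumes "joined E m A B" "X \<subseteq> A" "Y \<subseteq> B" "m \<le> card X" "m \<le> card Y" "X \<inter> Y = {}"
  obtains x y where "x \<in> X" "y \<in> Y" "E x y"
proof -
  obtain X' where X': "X' \<subseteq> X" "card X' = m" by (meson assms(4) obtain_subset_with_card_n)
  obtain Y' where Y': "Y' \<subseteq> Y" "card Y' = m" by (meson assms(5) obtain_subset_with_card_n)
  have "\<exists>x\<in>X'. \<exists>y\<in>Y'. E x y"
    using assms X' Y' unfolding joined_def
    by (metis (no_types, lifting) disjoint_iff order_trans subset_iff)
  then show ?thesis using that X' Y' by blast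
qed

text \<open>The vertices of \<open>B'\<close> without a neighbour in \<open>X\<close> send no edge
  to \<open>X\<close>, so \<open>m\<close> of them would contradict joinedness.\<close>

lemma joined_non_nbrs:
  assumes "joined E m A B" "X \<subseteq> A" "m \<le> card X" "X \<inter> B' = {}" "B' \<subseteq> B"
  shows "card (B' - nbrs E X B') < m"
proof (rule ccontr)
  assume "\<not> ?thesis"
  then have "m \<le> card (B' - nbrs E X B')" by simp
  moreover have "X \<inter> (B' - nbrs E X B') = {}" "B' - nbrs E X B' \<subseteq> B" using assms by auto
  ultimately obtain x y where "x \<in> X" "y \<in> B' - nbrs E X B'" "E x y"
    using joined_edge[OF assms(1,2) _ assms(3)] by metis
  then show False unfolding nbrs_def by auto
qed

lemma joined_nbrs:
  assumes "joined E m A B" "X \<subseteq> A" "m \<le> card X" "X \<inter> B' = {}" "B' \<subseteq> B" "finite B'" "m \<ge> 1"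
  shows "card B' + 1 \<le> card (nbrs E X B') + m"
proof -
  have "nbrs E X B' \<subseteq> B'" unfolding nbrs_def by auto
  then have "card (B' - nbrs E X B') = card B' - card (nbrs E X B')"
    using assms(6) by (meson card_Diff_subset finite_subset)
  then show ?thesis using joined_non_nbrs[OF assms(1-5)] by linarith
qed

lemma cross_imp: "cross E A B x y \<Longrightarrow> E x y"
  unfolding cross_def by blast

text \<open>A maximal set \<open>X\<close> with few neighbours has fewer than \<open>M\<close> elements, and adding a
non-expanding subset of its complement would contradict maximality.\<close>

lemma expander_subset:
  assumes fin: "finite Z"
    and big: "\<And>X. X \<subseteq> Z \<Longrightarrow> M \<le> card X \<Longrightarrow> card X \<le> M + 2 * m \<Longrightarrow> 3 * card X < card (nbrs E X (Z - X))"
  obtains Z' where "Z' \<subseteq> Z" "card (Z - Z') < M" "expands E m Z'"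
proof -
  let ?P = "\<lambda>X. X \<subseteq> Z \<and> card X \<le> M + 2 * m \<and> card (nbrs E X (Z - X)) \<le> 3 * card X"
  have "?P {}" by (simp add: nbrs_def)
  moreover have "\<forall>X. ?P X \<longrightarrow> card X < Suc (card Z)" using fin by (simp add: card_mono le_imp_less_Suc)
  ultimately obtain X where X: "?P X" and mx: "\<And>X'. ?P X' \<Longrightarrow> card X' \<le> card X"
    using ex_has_greatest_nat[of ?P "{}" card "Suc (card Z)"] by metis
  have lt: "card X < M"
  proof (rule ccontr)
    assume "\<not> card X < M"
    then show False using big[of X] X by simp
  qed
  have finX: "finite X" using X fin finite_subset by auto
  have "expands E m (Z - X)"
    unfolding expands_def
  proof (intro allI impI)
    fix Y assume Y: "Y \<subseteq> Z - X" "card Y \<le> 2 * m"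
    show "3 * card Y \<le> card (nbrs E Y (Z - X - Y))"
    proof (rule ccontr)
      assume neg: "\<not> ?thesis"
      have finY: "finite Y" using Y fin by (meson finite_Diff finite_subset)
      have cU: "card (X \<union> Y) = card X + card Y" using finX finY Y by (intro card_Un_disjoint) auto
      have "nbrs E (X \<union> Y) (Z - (X \<union> Y)) \<subseteq> nbrs E X (Z - X) \<union> nbrs E Y (Z - X - Y)"
        unfolding nbrs_def by auto
      moreover have f: "finite (nbrs E X (Z - X))" "finite (nbrs E Y (Z - X - Y))"
        using fin unfolding nbrs_def by auto
      ultimately have "card (nbrs E (X \<union> Y) (Z - (X \<union> Y))) \<le> card (nbrs E X (Z - X)) + card (nbrs E Y (Z - X - Y))"
        by (meson card_Un_le card_mono finite_UnI le_trans)
      then have "?P (X \<union> Y)" using X Y neg cU lt by auto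
      from mx[OF this] have "card Y = 0" using cU by simp
      then show False using neg by simp
    qed
  qed
  moreover have "Z - (Z - X) = X" using X by auto
  ultimately show ?thesis using that[of "Z - X"] lt by auto
qed

lemma expander_joined:
  assumes "joined E m W W" "finite W" "m \<ge> 1" "13 * m \<le> card W"
  obtains Z where "Z \<subseteq> W" "card (W - Z) < m" "expands E m Z"
proof -
  have big: "3 * card X < card (nbrs E X (W - X))" if X: "X \<subseteq> W" "m \<le> card X" "card X \<le> m + 2 * m" for X
  proof -
    have "card (W - X) = card W - card X" using X assms(2) by (meson card_Diff_subset finite_subset)
    \<comment> \<open>At least \<open>10 * m\<close> vertices lie outside \<open>X\<close> and fewer
      than \<open>m\<close> of them are not neighbours. More than \<open>9 * m\<close> remain, and
      \<open>3 * card X \<le> 9 * m\<close>.\<close>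
    moreover have "card (W - X) + 1 \<le> card (nbrs E X (W - X)) + m"
      using assms X by (intro joined_nbrs[OF assms(1)]) auto
    ultimately show ?thesis using X assms(4) by linarith
  qed
  show ?thesis by (rule expander_subset[OF assms(2) big that])
qed

lemma expander_bipartite:
  assumes j: "joined E m A B" and sy: "symp E" and fin: "finite A" "finite B" and dis: "A \<inter> B = {}"
    and m: "m \<ge> 1" and ca: "17 * m \<le> card A" "17 * m \<le> card B"
  obtains Z where "Z \<subseteq> A \<union> B" "card (A \<union> B - Z) < 2 * m" "expands (cross E A B) m Z"
proof -
  have half: "3 * card X < card (nbrs (cross E A B) X (A \<union> B - X))"
    if X: "X \<subseteq> A \<union> B" "card X \<le> 4 * m" "m \<le> card (X \<inter> C)" 
      and C: "C = A \<and> D = B \<or> C = B \<and> D = A" for X C D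
  proof -
    have jCD: "joined E m C D" using C j joined_sym[OF j sy] by auto
    have finX: "finite X" using X fin by (meson finite_UnI finite_subset)
    have "card D - card X \<le> card (D - X)" by (rule diff_card_le_card_Diff[OF finX])
    moreover have "card (D - X) + 1 \<le> card (nbrs E (X \<inter> C) (D - X)) + m"
      using C fin m X by (intro joined_nbrs[OF jCD]) auto
    moreover have "nbrs E (X \<inter> C) (D - X) \<subseteq> nbrs (cross E A B) X (A \<union> B - X)"
      using C unfolding nbrs_def cross_def by auto
    then have "card (nbrs E (X \<inter> C) (D - X)) \<le> card (nbrs (cross E A B) X (A \<union> B - X))"
      using fin by (intro card_mono) (auto simp: nbrs_def)
    moreover have "17 * m \<le> card D" using C ca by auto
    ultimately show ?thesis using X m by linarith
  qed
  have big: "3 * card X < card (nbrs (cross E A B) X (A \<union> B - X))"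
    if X: "X \<subseteq> A \<union> B" "2 * m \<le> card X" "card X \<le> 2 * m + 2 * m" for X
  proof -
    have "X = (X \<inter> A) \<union> (X \<inter> B)" using X by auto
    then have "card X \<le> card (X \<inter> A) + card (X \<inter> B)" by (metis card_Un_le)
    \<comment> \<open>Only one side of \<open>X\<close> is sure to reach size \<open>m\<close>,
      hence the threshold \<open>2 * m\<close>. That side sees all but fewer than \<open>m\<close>
      of at least \<open>13 * m\<close> vertices of the other side, which exceeds three times
      \<open>4 * m\<close>.\<close>
    then have "m \<le> card (X \<inter> A) \<or> m \<le> card (X \<inter> B)" using X by linarith
    then show ?thesis using half[of X A B] half[of X B A] X by auto
  qed
  show ?thesis by (rule expander_subset[OF _ big that]) (use fin in auto)
qed

section \<open>Binary trees in expanders, and cycles closed through two of them\<close>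

lemma tree_levels:
  assumes ex: "expands E m Z" and fin: "finite Z" and r: "r \<in> Z" and j: "2 ^ j \<le> 4 * m"
  shows "\<exists>L U. L \<subseteq> U \<and> U \<subseteq> Z \<and> card L = 2 ^ j \<and> card (U - L) < 2 ^ j \<and>
           (\<forall>y\<in>L. \<exists>p. path E r p y \<and> length p = Suc j \<and> set p \<subseteq> U)"
  using j
proof (induction j)
  case 0
  have "path E r [r] r" by (simp add: path_def)
  then show ?case using r by (intro exI[of _ "{r}"]) (auto intro!: exI[of _ "[r]"])
next
  case (Suc j)
  then obtain L U where LU: "L \<subseteq> U" "U \<subseteq> Z" "card L = 2 ^ j" "card (U - L) < 2 ^ j"
    and p: "\<forall>y\<in>L. \<exists>p. path E r p y \<and> length p = Suc j \<and> set p \<subseteq> U" by auto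
  \<comment> \<open>\<open>L\<close> is the last level and \<open>U\<close> the whole tree. Of at
    least \<open>3 * 2 ^ j\<close> neighbours of \<open>L\<close>, fewer than \<open>2 ^ j\<close>
    are on earlier levels; \<open>2 ^ Suc j\<close> of the others form the next level.\<close>
  let ?N = "nbrs E L (Z - L)"
  have finU: "finite U" using LU fin finite_subset by blast
  have "3 * 2 ^ j \<le> card ?N"
    using ex[unfolded expands_def, rule_format, of L] LU Suc.prems by auto
  moreover have "card ?N - card (U - L) \<le> card (?N - (U - L))" using finU by (intro diff_card_le_card_Diff) auto
  ultimately have "2 ^ Suc j \<le> card (?N - (U - L))" using LU(4) by simp
  then obtain L' where L': "L' \<subseteq> ?N - (U - L)" "card L' = 2 ^ Suc j" by (meson obtain_subset_with_card_n)
  have dis: "L' \<inter> U = {}" using L' unfolding nbrs_def by auto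
  have "card U = card L + card (U - L)" using finU LU(1)
    by (metis card_Diff_subset card_mono finite_subset le_add_diff_inverse)
  then have "card (U \<union> L' - L') < 2 ^ Suc j" using dis LU by (simp add: Un_Diff Diff_triv inf_commute)
  moreover have "\<exists>p. path E r p y \<and> length p = Suc (Suc j) \<and> set p \<subseteq> U \<union> L'" if y: "y \<in> L'" for y
  proof -
    obtain x where x: "x \<in> L" "E x y" using y L' unfolding nbrs_def by auto
    obtain p where p: "path E r p x" "length p = Suc j" "set p \<subseteq> U" using x p by blast
    have "y \<notin> set p" using y dis p by auto
    then have "path E r (p @ [y]) y" using p x unfolding path_def
      by (auto simp: successively_append_iff)
    then show ?thesis using p y by (intro exI[of _ "p @ [y]"]) auto
  qed
  moreover have "U \<union> L' \<subseteq> Z" using LU L' unfolding nbrs_def by auto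
  ultimately show ?case using L' by (intro exI[of _ L'] exI[of _ "U \<union> L'"]) auto
qed

lemma cross_path_side:
  assumes "successively (cross E A B) p" "A \<inter> B = {}" "p \<noteq> []" "hd p \<in> A"
  shows "last p \<in> (if even (length p) then B else A) \<and> set p \<subseteq> A \<union> B"
  using assms
proof (induction p arbitrary: A B)
  case (Cons x p)
  show ?case
  proof (cases p)
    case (Cons y q)
    \<comment> \<open>Dropping the first vertex moves the start to the other side, so the induction
      hypothesis is used with \<open>A\<close> and \<open>B\<close> exchanged.\<close>
    have "cross E A B = cross E B A" by (auto simp: cross_def fun_eq_iff)
    moreover have "hd p \<in> B" using Cons.prems Cons by (auto simp: cross_def)
    ultimately have "last p \<in> (if even (length p) then A else B) \<and> set p \<subseteq> B \<union> A"
      using Cons.IH[of B A] Cons.prems Cons by (metis Int_commute list.distinct(1) successively_Cons)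
    then show ?thesis using Cons.prems Cons by auto
  qed (use Cons.prems in auto)
qed simp

lemma successively_imp: "successively E p \<Longrightarrow> (\<And>x y. E x y \<Longrightarrow> E' x y) \<Longrightarrow> successively E' p"
  by (metis successively_mono)

text \<open>The cycle runs from the leaf \<open>y1\<close> back to \<open>r1\<close>, along
  \<open>Q\<close>, from \<open>r2\<close> out to \<open>y2\<close>, and returns over the edge
  between the two leaves.\<close>

lemma close_cycle:
  assumes sy: "symp E" and p1: "path E r1 p1 y1" and p2: "path E r2 p2 y2"
    and Q: "Q \<noteq> []" "distinct Q" "successively E Q" "E r1 (hd Q)" "E (last Q) r2"
    and dis: "set p1 \<inter> set p2 = {}" "set p1 \<inter> set Q = {}" "set p2 \<inter> set Q = {}"
    and e: "E y1 y2"
  shows "cyc E (length p1 + length Q + length p2)"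
  unfolding cyc_def
proof (intro exI[of _ "rev p1 @ Q @ p2"] conjI)
  have "(\<lambda>x y. E y x) = E" using sy by (auto simp: fun_eq_iff symp_def)
  then have "successively E (rev p1)" using p1 unfolding path_def by (metis successively_rev)
  then show "successively E (rev p1 @ Q @ p2)"
    using Q p1 p2 unfolding path_def by (auto simp: successively_append_iff last_rev hd_append)
  show "E (last (rev p1 @ Q @ p2)) (hd (rev p1 @ Q @ p2))"
    using p1 p2 Q e sy unfolding path_def by (auto simp: hd_append hd_rev symp_def)
  show "distinct (rev p1 @ Q @ p2)"
    using p1 p2 Q dis unfolding path_def by auto
  show "rev p1 @ Q @ p2 \<noteq> []" using Q by simp
qed simp

text \<open>Depth \<open>h\<close> or \<open>Suc h\<close> gives at least \<open>m\<close> leaves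
  and at most \<open>4 * m\<close>, the limit of the expansion. The choice between the two depths
  tunes the parity of the cycle. \<open>C\<close> and \<open>D\<close> name the sides on which the
  leaves lie, since an edge may be guaranteed only between particular sides.\<close>

lemma cycle_through_trees:
  assumes sy: "symp E" and m: "m \<le> 2 ^ h" "2 ^ h < 2 * m"
    and E1: "\<And>x y. E1 x y \<Longrightarrow> E x y" and E2: "\<And>x y. E2 x y \<Longrightarrow> E x y"
    and Z1: "expands E1 m Z1" "finite Z1" "r1 \<in> Z1" and Z2: "expands E2 m Z2" "finite Z2" "r2 \<in> Z2"
    and dis: "Z1 \<inter> Z2 = {}" "set Q \<inter> (Z1 \<union> Z2) = {}"
    and Q: "Q \<noteq> []" "distinct Q" "successively E Q" "E r1 (hd Q)" "E (last Q) r2"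
    and j1: "j1 = h \<or> j1 = Suc h" and j2: "j2 = h \<or> j2 = Suc h"
    and C1: "\<And>p y. path E1 r1 p y \<Longrightarrow> length p = Suc j1 \<Longrightarrow> y \<in> C"
    and C2: "\<And>p y. path E2 r2 p y \<Longrightarrow> length p = Suc j2 \<Longrightarrow> y \<in> D"
    and j: "joined E m (Z1 \<inter> C) (Z2 \<inter> D)"
  shows "cyc E (j1 + j2 + 2 + length Q)"
proof -
  have "2 ^ j1 \<le> 4 * m" "2 ^ j2 \<le> 4 * m" using j1 j2 m by auto
  then obtain L1 U1 L2 U2 where
    L1: "L1 \<subseteq> U1" "U1 \<subseteq> Z1" "card L1 = 2 ^ j1"
      "\<forall>y\<in>L1. \<exists>p. path E1 r1 p y \<and> length p = Suc j1 \<and> set p \<subseteq> U1" and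
    L2: "L2 \<subseteq> U2" "U2 \<subseteq> Z2" "card L2 = 2 ^ j2"
      "\<forall>y\<in>L2. \<exists>p. path E2 r2 p y \<and> length p = Suc j2 \<and> set p \<subseteq> U2"
    using tree_levels[OF Z1] tree_levels[OF Z2] by metis
  have "m \<le> card L1" "m \<le> card L2" using L1 L2 j1 j2 m by auto
  moreover have "L1 \<subseteq> Z1 \<inter> C" "L2 \<subseteq> Z2 \<inter> D" using L1 L2 C1 C2 by blast+
  ultimately obtain y1 y2 where y: "y1 \<in> L1" "y2 \<in> L2" "E y1 y2"
    using joined_edge[OF j, of L1 L2] dis by (metis (no_types, lifting) disjoint_iff IntD1 subsetD)
  obtain p1 where p1: "path E1 r1 p1 y1" "length p1 = Suc j1" "set p1 \<subseteq> U1" using L1 y by blast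
  obtain p2 where p2: "path E2 r2 p2 y2" "length p2 = Suc j2" "set p2 \<subseteq> U2" using L2 y by blast
  have "path E r1 p1 y1" "path E r2 p2 y2"
    using p1 p2 E1 E2 unfolding path_def by (auto intro: successively_imp)
  from close_cycle[OF sy this Q _ _ _ y(3)]
  have "cyc E (length p1 + length Q + length p2)" using p1 p2 L1 L2 dis by blast
  then show ?thesis using p1 p2 by (simp add: algebra_simps)
qed

section \<open>Paths of prescribed length\<close>

lemma cross_path_count:
  assumes "successively (cross E A B) p" "A \<inter> B = {}"
  shows "2 * length (filter (\<lambda>x. x \<in> B) p) \<le> length p + 1"
  using assms(1)
proof (induction p rule: induct_list012)
  case (3 x y zs)
  have "\<not> (x \<in> B \<and> y \<in> B)" using 3(3) assms(2) by (auto simp: cross_def)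
  moreover have "2 * length (filter (\<lambda>x. x \<in> B) zs) \<le> length zs + 1" 
    using 3 by (cases zs) auto
  ultimately show ?case by auto
qed auto

text \<open>Depth-first search: \<open>S\<close> holds the finished vertices and \<open>P\<close> the current path, and there is no edge from
\<open>S\<close> to the unvisited vertices. Each step increases \<open>2 |S| + |P|\<close>, so a state maximising this
among those with \<open>|S \<inter> A|, |S \<inter> B| \<le> m\<close> is one where one of the two bounds is attained.\<close>

lemma long_path_state:
  assumes j: "joined E m A B" and sy: "symp E" and fin: "finite A" "finite B" and dis: "A \<inter> B = {}"
    and m: "m \<ge> 1" and ca: "q + 2 * m \<le> card A" "q + 2 * m \<le> card B"
  obtains P where "distinct P" "successively (cross E A B) P" "set P \<subseteq> A \<union> B" "2 * q + 1 \<le> length P"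
proof -
  define inv where "inv = (\<lambda>(S, P). S \<subseteq> A \<union> B \<and> distinct P \<and> set P \<subseteq> A \<union> B - S \<and> 
    successively (cross E A B) P \<and> (\<forall>x\<in>S. \<forall>y\<in>A \<union> B - S - set P. \<not> cross E A B x y) \<and>
    card (S \<inter> A) \<le> m \<and> card (S \<inter> B) \<le> m)"
  define val where "val = (\<lambda>(S :: 'a set, P :: 'a list). 2 * card S + length P)"
  have finAB: "finite (A \<union> B)" using fin by simp
  have "inv ({}, [])" unfolding inv_def by simp
  moreover have "\<forall>s. inv s \<longrightarrow> val s < 3 * card (A \<union> B) + 1"
  proof (intro allI impI)
    fix s assume s: "inv s"
    obtain S P where SP: "s = (S, P)" by fastforce
    have "card S \<le> card (A \<union> B)" using s SP finAB unfolding inv_def by (auto intro: card_mono)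
    moreover have "card (set P) \<le> card (A \<union> B)" using s SP finAB unfolding inv_def by (auto intro!: card_mono)
    moreover have "length P = card (set P)" using s SP unfolding inv_def by (simp add: distinct_card)
    ultimately show "val s < 3 * card (A \<union> B) + 1" unfolding val_def SP by simp
  qed
  ultimately obtain s where "inv s" and mx: "\<And>s'. inv s' \<Longrightarrow> val s' \<le> val s"
    using ex_has_greatest_nat[of inv "({}, [])" val "3 * card (A \<union> B) + 1"] by metis
  obtain S P where SP: "s = (S, P)" by fastforce
  let ?T = "A \<union> B - S - set P"
  have S: "S \<subseteq> A \<union> B" "distinct P" "set P \<subseteq> A \<union> B - S" "successively (cross E A B) P"
    "\<And>x y. x \<in> S \<Longrightarrow> y \<in> ?T \<Longrightarrow> \<not> cross E A B x y" "card (S \<inter> A) \<le> m" "card (S \<inter> B) \<le> m"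
    using \<open>inv s\<close> unfolding SP inv_def by auto
  have finS: "finite S" using S finAB finite_subset by blast
  have full: "card (S \<inter> A) = m \<or> card (S \<inter> B) = m"
  proof (rule ccontr)
    assume "\<not> ?thesis"
    then have lt: "card (S \<inter> A) < m" "card (S \<inter> B) < m" using S by auto
    have room: "card (insert x S \<inter> A) \<le> m" "card (insert x S \<inter> B) \<le> m" for x
      using lt finS by (auto simp: Int_insert_left card_insert_if)
    \<comment> \<open>Three moves are possible: start a path outside \<open>S\<close>, extend the
      path at its last vertex, or retire that vertex to \<open>S\<close> when it has no unvisited
      neighbour. Each keeps \<open>inv\<close> and raises \<open>val\<close> by one.\<close>
    show False
    proof (cases "P = []")
      case True
      have "\<not> card A \<le> card (S \<inter> A)" using lt ca by linarith
      then have "\<not> A \<subseteq> S \<inter> A" using card_mono[of "S \<inter> A" A] finS by blast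
      then obtain x where x: "x \<in> A" "x \<notin> S" by auto
      have "inv (S, [x])" unfolding inv_def using S x True by auto
      from mx[OF this] show False unfolding SP val_def True by simp
    next
      case False
      show False
      proof (cases "\<exists>y\<in>?T. cross E A B (last P) y")
        case True
        then obtain y where y: "y \<in> ?T" "cross E A B (last P) y" by auto
        have "inv (S, P @ [y])" unfolding inv_def using S y False by (auto simp: successively_append_iff)
        from mx[OF this] show False unfolding SP val_def by simp
      next
        case no: False
        obtain P0 x where P: "P = P0 @ [x]" using False by (cases P rule: rev_cases) auto
        have bl: "set P = insert x (set P0)" "distinct P0" "x \<notin> set P0" "successively (cross E A B) P0"
          using S(2,4) unfolding P by (auto simp: successively_append_iff)
        have T': "A \<union> B - insert x S - set P0 = ?T" using bl S(3) by auto
        have "inv (insert x S, P0)"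
          unfolding inv_def prod.case T' using S room[of x] no bl P by auto
        from mx[OF this] have "2 * card (insert x S) + length (P0) \<le> 2 * card S + length P"
          unfolding SP val_def by simp
        moreover have "x \<notin> S" using bl S by auto
        ultimately show False using finS P by simp 
      qed
    qed
  qed
  \<comment> \<open>\<open>C\<close> is a side with \<open>m\<close> finished vertices. They have no
    edge to unvisited ones, so fewer than \<open>m\<close> vertices of \<open>D\<close> are
    unvisited; at most \<open>m\<close> are finished, so more than \<open>q\<close> lie on the path,
    which alternates between the sides.\<close>
  have side: "2 * q + 1 \<le> length P" if C: "C = A \<and> D = B \<or> C = B \<and> D = A" and cS: "card (S \<inter> C) = m" for C D
  proof -
    have jCD: "joined E m C D" using C j joined_sym[OF j sy] by auto
    have "card (?T \<inter> D) < m"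
    proof (rule ccontr)
      assume "\<not> ?thesis"
      then have "m \<le> card (?T \<inter> D)" by simp
      then obtain x y where "x \<in> S \<inter> C" "y \<in> ?T \<inter> D" "E x y"
        by (rule joined_edge[OF jCD, of "S \<inter> C" "?T \<inter> D", rotated 3]) (use cS in auto)
      then show False using S(5)[of x y] C unfolding cross_def by auto
    qed
    moreover have "D = (S \<inter> D) \<union> (set P \<inter> D) \<union> (?T \<inter> D)" using C S by auto
    then have "card D \<le> card (S \<inter> D) + card (set P \<inter> D) + card (?T \<inter> D)"
      by (metis (no_types, lifting) card_Un_le add_le_mono1 le_trans)
    moreover have "card (S \<inter> D) \<le> m" "q + 2 * m \<le> card D" using C S ca by auto
    ultimately have "q + 1 \<le> card (set P \<inter> D)" by linarith
    moreover have "card (set P \<inter> D) = length (filter (\<lambda>x. x \<in> D) P)"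
      using S(2) by (metis distinct_card distinct_filter inf_commute Int_def mem_Collect_eq set_filter Collect_cong)
    moreover have "successively (cross E C D) P" using C S(4) by (auto elim!: successively_imp simp: cross_def)
    then have "2 * length (filter (\<lambda>x. x \<in> D) P) \<le> length P + 1" using C dis cross_path_count by blast
    ultimately show ?thesis by linarith
  qed
  have "2 * q + 1 \<le> length P" using full side by blast
  then show ?thesis using that S by blast
qed

lemma long_path:
  assumes j: "joined E m A B" and sy: "symp E" and fin: "finite A" "finite B" and dis: "A \<inter> B = {}"
    and m: "m \<ge> 1" and ca: "q + 2 * m \<le> card A" "q + 2 * m \<le> card B" and q: "q \<ge> 1"
  obtains Q where "length Q = 2 * q" "distinct Q" "successively E Q" "set Q \<subseteq> A \<union> B" "hd Q \<in> A" "last Q \<in> B"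
proof -
  obtain P where P: "distinct P" "successively (cross E A B) P" "set P \<subseteq> A \<union> B" "2 * q + 1 \<le> length P"
    using long_path_state[OF j sy fin dis m ca] by blast
  obtain x y zs where xy: "P = x # y # zs" using P(4) q by (cases P; cases "tl P") auto
  obtain R where R: "distinct R" "successively (cross E A B) R" "set R \<subseteq> A \<union> B" "2 * q \<le> length R" "hd R \<in> A"
  proof (cases "x \<in> A")
    case True
    then show ?thesis using that[of P] P xy by auto
  next
    case False
    then have "y \<in> A" using P xy by (auto simp: cross_def)
    then show ?thesis using that[of "y # zs"] P xy by auto
  qed
  let ?Q = "take (2 * q) R"
  have Q: "length ?Q = 2 * q" "?Q \<noteq> []" using R q by auto
  have "successively (cross E A B) ?Q" using R(2) by (metis append_take_drop_id successively_append_iff)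
  moreover have "hd ?Q \<in> A" using R q by (simp add: hd_take)
  ultimately have "last ?Q \<in> B" using cross_path_side[OF _ dis Q(2)] Q(1) by fastforce
  moreover have "successively E ?Q"
    using \<open>successively (cross E A B) ?Q\<close> by (auto intro: successively_imp cross_imp)
  moreover have "set ?Q \<subseteq> A \<union> B" using R(3) by (meson order_trans set_take_subset)
  ultimately show ?thesis using that[of ?Q] Q R \<open>hd ?Q \<in> A\<close> by auto
qed

text \<open>Restricting \<open>A\<close> to the neighbours of \<open>S\<close> and \<open>B\<close>
  to those of \<open>T\<close> costs fewer than \<open>m\<close> vertices each, and a path found
  there has both ends attached.\<close>

lemma attached_path:
  assumes j: "joined E m A B" and sy: "symp E" and fin: "finite A" "finite B" and dis: "A \<inter> B = {}"
    and m: "m \<ge> 1" and ca: "q + 3 * m \<le> card A" "q + 3 * m \<le> card B" and q: "q \<ge> 1"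
    and S: "joined E m S A" "S \<inter> A = {}" "m \<le> card S"
    and T: "joined E m T B" "T \<inter> B = {}" "m \<le> card T"
  obtains s Q t where "length Q = 2 * q" "distinct Q" "successively E Q" "set Q \<subseteq> A \<union> B"
    "s \<in> S" "t \<in> T" "E s (hd Q)" "E (last Q) t"
proof -
  let ?A = "nbrs E S A" let ?B = "nbrs E T B"
  have "card A + 1 \<le> card ?A + m" using joined_nbrs[OF S(1) _ S(3,2) _ fin(1) m] by simp
  then have cA: "q + 2 * m \<le> card ?A" using ca by linarith
  have "card B + 1 \<le> card ?B + m" using joined_nbrs[OF T(1) _ T(3,2) _ fin(2) m] by simp
  then have cB: "q + 2 * m \<le> card ?B" using ca by linarith
  have sub: "?A \<subseteq> A" "?B \<subseteq> B" unfolding nbrs_def by auto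
  obtain Q where Q: "length Q = 2 * q" "distinct Q" "successively E Q" "set Q \<subseteq> ?A \<union> ?B" "hd Q \<in> ?A" "last Q \<in> ?B"
    using long_path[OF joined_mono[OF j sub] sy _ _ _ m cA cB q] sub fin dis by (metis (no_types, lifting) 
      finite_subset Int_mono subset_empty)
  from Q(5) obtain s where "s \<in> S" "E s (hd Q)" unfolding nbrs_def by auto
  moreover from Q(6) obtain t where "t \<in> T" "E t (last Q)" unfolding nbrs_def by auto
  moreover have "set Q \<subseteq> A \<union> B" using Q(4) sub by auto
  ultimately show ?thesis using that[of Q s t] Q sy by (auto dest: sympD)
qed

section \<open>Cycles of prescribed length\<close>

lemma split_card:
  assumes "a + b \<le> card A"
  obtains A1 A2 where "A1 \<subseteq> A" "A2 \<subseteq> A" "A1 \<inter> A2 = {}" "card A1 = a" "b \<le> card A2" "A2 = A - A1"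
proof -
  obtain A1 where A1: "A1 \<subseteq> A" "card A1 = a" using assms by (meson add_leD1 obtain_subset_with_card_n)
  show ?thesis
  proof (cases "finite A")
    case True
    then have "card (A - A1) = card A - a" using A1 by (meson card_Diff_subset finite_subset)
    then show ?thesis using that[of A1 "A - A1"] A1 assms by auto
  next
    \<comment> \<open>An infinite set has \<open>card A = 0\<close>, which forces
      \<open>a = b = 0\<close>.\<close>
    case False
    then have "a = 0" "b = 0" using assms by auto
    then show ?thesis using that[of A1 "A - A1"] A1 by auto
  qed
qed

lemma disjoint_mono: "A \<inter> B = {} \<Longrightarrow> A' \<subseteq> A \<Longrightarrow> B' \<subseteq> B \<Longrightarrow> A' \<inter> B' = {}"
  by blast

lemma obtain_depth:
  assumes "m \<ge> (1::nat)"
  obtains h where "m \<le> 2 ^ h" "2 ^ h < 2 * m"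
proof -
  obtain h where h: "m \<le> 2 ^ h" "\<And>k. k < h \<Longrightarrow> \<not> m \<le> 2 ^ k"
    using exists_least_iff[of "\<lambda>h. m \<le> 2 ^ h"] less_exp[of m] by (metis less_imp_le)
  have "2 ^ h < 2 * m"
    using h(2)[of "h - 1"] assms by (cases h) auto
  then show ?thesis using that h by blast
qed

lemma depth_bound:
  assumes "2 ^ h < 2 * m" "2 ^ c * m \<le> (2::nat) ^ K"
  shows "h + c \<le> K"
proof -
  have "2 ^ (h + c) = 2 ^ c * (2::nat) ^ h" by (simp add: power_add)
  also have "\<dots> < 2 ^ c * (2 * m)" using assms(1) by simp
  also have "\<dots> = 2 * (2 ^ c * m)" by simp
  also have "\<dots> \<le> 2 * 2 ^ K" using assms(2) by (rule mult_le_mono2)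
  finally have "2 ^ (h + c) < (2::nat) ^ (K + 1)" by simp
  then show ?thesis by (metis less_Suc_eq_le Suc_eq_plus1 one_less_numeral_iff power_less_imp_less_exp semiring_norm(76))
qed

lemma odd_cycle_in_joined:
  assumes j: "joined E m W W" and sy: "symp E" and fin: "finite W" and m: "m \<ge> 1"
    and ca: "41 * m \<le> card W" "card W \<le> 2 ^ K" and l: "odd l" "2 * K + 1 \<le> l" "l \<le> m"
  shows "cyc E l"
proof -
  obtain h where h: "m \<le> 2 ^ h" "2 ^ h < 2 * m" using obtain_depth[OF m] by blast
  \<comment> \<open>As \<open>16 * m\<close> is at most \<open>2 ^ K\<close>, logarithmic trees are
    shallow: \<open>2 * h + 9 \<le> l\<close>, which leaves room for a nonempty path.\<close>
  have hK: "h + 4 \<le> K" using depth_bound[OF h(2), of 4 K] ca by simp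
  \<comment> \<open>Trees of depths \<open>h\<close> and \<open>Suc h\<close> with a path on
    \<open>2 * q\<close> vertices give a cycle of length
    \<open>h + Suc h + 2 + 2 * q\<close>.\<close>
  obtain q where q: "l = 2 * q + 2 * h + 3" "q \<ge> 1"
  proof -
    from l(1) obtain k where "l = 2 * k + 1" by (rule oddE)
    then show ?thesis by (intro that[of "k - h - 1"]) (use l(2) hK in linarith)+
  qed
  have qm: "q + 3 * m \<le> 4 * m" using q l by simp
  \<comment> \<open>The budget is \<open>13 * m\<close> for each of two expanders, and
    \<open>4 * m\<close> and \<open>11 * m\<close> for the two sides of the path.\<close>
  have "13 * m + 28 * m \<le> card W" using ca by simp
  then obtain V1 R1 where 1: "V1 \<subseteq> W" "R1 \<subseteq> W" "V1 \<inter> R1 = {}" "card V1 = 13 * m" "28 * m \<le> card R1" by (rule split_card) blast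
  have "13 * m + 15 * m \<le> card R1" using 1 by simp
  then obtain V2 R2 where 2: "V2 \<subseteq> R1" "R2 \<subseteq> R1" "V2 \<inter> R2 = {}" "card V2 = 13 * m" "15 * m \<le> card R2" by (rule split_card) blast
  have "4 * m + 11 * m \<le> card R2" using 2 by simp
  then obtain A B where 3: "A \<subseteq> R2" "B \<subseteq> R2" "A \<inter> B = {}" "card A = 4 * m" "11 * m \<le> card B" by (rule split_card) blast
  have sub: "V1 \<subseteq> W" "V2 \<subseteq> W" "A \<subseteq> W" "B \<subseteq> W" using 1 2 3 by auto
  have dV: "V1 \<inter> V2 = {}" "V1 \<inter> A = {}" "V1 \<inter> B = {}" "V2 \<inter> A = {}" "V2 \<inter> B = {}"
    using disjoint_mono[OF 1(3) order_refl] disjoint_mono[OF 2(3) order_refl] 2(1,2) 3(1,2)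
    by (meson order_trans)+
  have finV: "finite V1" "finite V2" "finite A" "finite B" using sub fin finite_subset by blast+
  obtain Z1 where Z1: "Z1 \<subseteq> V1" "card (V1 - Z1) < m" "expands E m Z1"
    using expander_joined[OF joined_mono[OF j sub(1,1)] finV(1) m] 1 by auto
  obtain Z2 where Z2: "Z2 \<subseteq> V2" "card (V2 - Z2) < m" "expands E m Z2"
    using expander_joined[OF joined_mono[OF j sub(2,2)] finV(2) m] 2 by auto
  have cZ: "m \<le> card Z1" "m \<le> card Z2"
    using Z1 Z2 1 2 finV by (auto simp: card_Diff_subset finite_subset)
  have jj: "joined E m X Y" if "X \<subseteq> W" "Y \<subseteq> W" for X Y using joined_mono[OF j] that by blast
  obtain s Q t where Q: "length Q = 2 * q" "distinct Q" "successively E Q" "set Q \<subseteq> A \<union> B"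
    "s \<in> Z1" "t \<in> Z2" "E s (hd Q)" "E (last Q) t"
  proof (rule attached_path[of E m A B q Z1 Z2])
    have "Z1 \<subseteq> W" "Z2 \<subseteq> W" using Z1(1) Z2(1) sub by auto
    then show "joined E m A B" "joined E m Z1 A" "joined E m Z2 B" using jj[of A B] jj[of Z1 A] jj[of Z2 B] sub by simp_all
    show "Z1 \<inter> A = {}" "Z2 \<inter> B = {}" 
      using disjoint_mono[OF dV(2) Z1(1) order_refl] disjoint_mono[OF dV(5) Z2(1) order_refl] by auto
    show "q + 3 * m \<le> card A" "q + 3 * m \<le> card B" using qm 3 by auto
  qed (use sy finV 3 m q cZ in auto)
  have "cyc E (h + Suc h + 2 + length Q)"
  proof (rule cycle_through_trees[OF sy h _ _ Z1(3) _ Q(5) Z2(3) _ Q(6), where C = UNIV and D = UNIV])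
    show "finite Z1" "finite Z2" using Z1(1) Z2(1) finV by (meson finite_subset finite_UnI)+
    show "Z1 \<inter> Z2 = {}" using disjoint_mono[OF dV(1) Z1(1) Z2(1)] .
    have "(A \<union> B) \<inter> (V1 \<union> V2) = {}" using dV by (simp add: Int_Un_distrib Int_Un_distrib2 Int_commute)
    then show "set Q \<inter> (Z1 \<union> Z2) = {}" by (rule disjoint_mono[OF _ Q(4) Un_mono[OF Z1(1) Z2(1)]])
    show "joined E m (Z1 \<inter> UNIV) (Z2 \<inter> UNIV)" using jj[of Z1 Z2] Z1(1) Z2(1) sub by simp
    show "Q \<noteq> []" using Q q by auto
  qed (use Q in auto)
  moreover have "h + Suc h + 2 + length Q = l" using q(1) Q(1) by simp
  ultimately show ?thesis by simp
qed

lemma cross_path_end: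
  assumes "path (cross E A B) r p y" "A \<inter> B = {}" "r \<in> A" "length p = Suc j"
  shows "y \<in> (if even j then A else B)"
  using cross_path_side[of E A B p] assms unfolding path_def by (auto split: if_splits)

lemma large_Int:
  assumes "card (U - Z) < 2 * m" "X \<subseteq> U" "card X = 17 * m" "finite U"
  shows "m \<le> card (Z \<inter> X)"
proof -
  have "card (X - Z) \<le> card (U - Z)" using assms by (intro card_mono) auto
  moreover have "X = (Z \<inter> X) \<union> (X - Z)" by auto
  then have "card X \<le> card (Z \<inter> X) + card (X - Z)" by (metis card_Un_le)
  ultimately show ?thesis using assms by linarith
qed

lemma even_cycle_in_joined:
  assumes j: "joined E m A B" and sy: "symp E" and fin: "finite A" "finite B" and dis: "A \<inter> B = {}" and m: "m \<ge> 1"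
    and ca: "40 * m \<le> card A" "40 * m \<le> card B" "card A \<le> 2 ^ K" and l: "even l" "2 * K + 1 \<le> l" "l \<le> m"
  shows "cyc E l"
proof -
  obtain h where h: "m \<le> 2 ^ h" "2 ^ h < 2 * m" using obtain_depth[OF m] by blast
  have hK: "h + 4 \<le> K" using depth_bound[OF h(2), of 4 K] ca by simp
  obtain q where q: "l = 2 * q + 2 * h + 2" "q \<ge> 1"
  proof -
    from l(1) obtain k where "l = 2 * k" by (rule evenE)
    then show ?thesis by (intro that[of "k - h - 1"]) (use l(2) hK in linarith)+
  qed
  have qm: "q + 3 * m \<le> 4 * m" using q l by simp
  \<comment> \<open>Each side provides \<open>17 * m\<close> vertices for each of two bipartite
    expanders and \<open>6 * m\<close> for the path.\<close>
  have "17 * m + 23 * m \<le> card A" using ca by simp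
  then obtain A1 R1 where A1: "A1 \<subseteq> A" "R1 \<subseteq> A" "A1 \<inter> R1 = {}" "card A1 = 17 * m" "23 * m \<le> card R1" by (rule split_card) blast
  have "17 * m + 6 * m \<le> card R1" using A1 by simp
  then obtain A2 A3 where A2: "A2 \<subseteq> R1" "A3 \<subseteq> R1" "A2 \<inter> A3 = {}" "card A2 = 17 * m" "6 * m \<le> card A3" by (rule split_card) blast
  have "17 * m + 23 * m \<le> card B" using ca by simp
  then obtain B1 S1 where B1: "B1 \<subseteq> B" "S1 \<subseteq> B" "B1 \<inter> S1 = {}" "card B1 = 17 * m" "23 * m \<le> card S1" by (rule split_card) blast
  have "17 * m + 6 * m \<le> card S1" using B1 by simp
  then obtain B2 B3 where B2: "B2 \<subseteq> S1" "B3 \<subseteq> S1" "B2 \<inter> B3 = {}" "card B2 = 17 * m" "6 * m \<le> card B3" by (rule split_card) blast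
  have sub: "A1 \<subseteq> A" "A2 \<subseteq> A" "A3 \<subseteq> A" "B1 \<subseteq> B" "B2 \<subseteq> B" "B3 \<subseteq> B" using A1 A2 B1 B2 by auto
  have finV: "finite A1" "finite A2" "finite A3" "finite B1" "finite B2" "finite B3" 
    using sub fin finite_subset by blast+
  have disj: "A1 \<inter> B1 = {}" "A2 \<inter> B2 = {}" "B1 \<inter> A1 = {}" using sub dis by auto
  have "A1 \<inter> A2 = {}" "A1 \<inter> A3 = {}" "B1 \<inter> B2 = {}" "B1 \<inter> B3 = {}"
    using disjoint_mono[OF A1(3) order_refl] disjoint_mono[OF B1(3) order_refl] A2(1,2) B2(1,2) by auto
  moreover have "X \<inter> Y = {}" "Y \<inter> X = {}" if "X \<subseteq> A" "Y \<subseteq> B" for X Y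
    using disjoint_mono[OF dis that] by auto
  ultimately have dU: "(A1 \<union> B1) \<inter> (A2 \<union> B2) = {}" "(A3 \<union> B3) \<inter> (A1 \<union> B1 \<union> (A2 \<union> B2)) = {}"
    using sub A2(3) B2(3) by (auto simp: Int_Un_distrib Int_Un_distrib2 Int_commute)
  have j': "joined E m B A" using joined_sym[OF j sy] .
  obtain Z1 where Z1: "Z1 \<subseteq> A1 \<union> B1" "card (A1 \<union> B1 - Z1) < 2 * m" "expands (cross E A1 B1) m Z1"
    using expander_bipartite[OF joined_mono[OF j sub(1,4)] sy finV(1,4) disj(1) m] A1 B1 by auto
  obtain Z2 where Z2: "Z2 \<subseteq> A2 \<union> B2" "card (A2 \<union> B2 - Z2) < 2 * m" "expands (cross E A2 B2) m Z2"
    using expander_bipartite[OF joined_mono[OF j sub(2,5)] sy finV(2,5) disj(2) m] A2 B2 by auto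
  have cZ: "m \<le> card (Z1 \<inter> B1)" "m \<le> card (Z2 \<inter> A2)"
    using large_Int[OF Z1(2), of B1] large_Int[OF Z2(2), of A2] A2 B1 finV by auto
  obtain s Q t where Q: "length Q = 2 * q" "distinct Q" "successively E Q" "set Q \<subseteq> A3 \<union> B3"
    "s \<in> Z1 \<inter> B1" "t \<in> Z2 \<inter> A2" "E s (hd Q)" "E (last Q) t"
  proof (rule attached_path[of E m A3 B3 q "Z1 \<inter> B1" "Z2 \<inter> A2"])
    show "joined E m A3 B3" using joined_mono[OF j sub(3,6)] .
    show "joined E m (Z1 \<inter> B1) A3" using joined_mono[OF j', of "Z1 \<inter> B1" A3] sub by auto
    show "joined E m (Z2 \<inter> A2) B3" using joined_mono[OF j, of "Z2 \<inter> A2" B3] sub by auto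
    show "Z1 \<inter> B1 \<inter> A3 = {}" "Z2 \<inter> A2 \<inter> B3 = {}" "A3 \<inter> B3 = {}" using dis sub by blast+
    show "q + 3 * m \<le> card A3" "q + 3 * m \<le> card B3" using qm A2 B2 by auto
  qed (use sy finV m q cZ in auto)
  \<comment> \<open>The roots lie on opposite sides, \<open>s\<close> in \<open>B1\<close> and
    \<open>t\<close> in \<open>A2\<close>. After \<open>h\<close> steps from each, the leaves are
    again on opposite sides, where joinedness applies.\<close>
  let ?L1 = "if even h then B1 else A1" and ?L2 = "if even h then A2 else B2"
  have "cyc E (h + h + 2 + length Q)"
  proof (rule cycle_through_trees[OF sy h _ _ Z1(3) _ _ Z2(3) _ _, where C = ?L1 and D = ?L2])
    show "finite Z1" "finite Z2" using Z1(1) Z2(1) finV by (meson finite_subset finite_UnI)+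
    show "Z1 \<inter> Z2 = {}" by (rule disjoint_mono[OF dU(1) Z1(1) Z2(1)])
    show "set Q \<inter> (Z1 \<union> Z2) = {}" 
      by (rule disjoint_mono[OF dU(2) Q(4) Un_mono[OF Z1(1) Z2(1)]])
    show "Q \<noteq> []" using Q q by auto
    have "cross E A1 B1 = cross E B1 A1" by (auto simp: cross_def fun_eq_iff)
    then show "y \<in> ?L1" if "path (cross E A1 B1) s p y" "length p = Suc h" for p y
      using cross_path_end[of E B1 A1 s p y h] that disj Q by auto
    show "y \<in> ?L2" if "path (cross E A2 B2) t p y" "length p = Suc h" for p y
      using cross_path_end[of E A2 B2 t p y h] that disj Q by auto
    show "joined E m (Z1 \<inter> ?L1) (Z2 \<inter> ?L2)"
      using joined_mono[OF j' le_infI2[OF sub(4)] le_infI2[OF sub(2)]]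
        joined_mono[OF j le_infI2[OF sub(1)] le_infI2[OF sub(5)]] by simp
  qed (use Q in \<open>auto simp: cross_def\<close>)
  moreover have "h + h + 2 + length Q = l" using q(1) Q(1) by simp
  ultimately show ?thesis by simp
qed

section \<open>Odd cycles that switch parity through a second joined pair\<close>

text \<open>A smallest set \<open>D\<close> of values with at least \<open>m\<close> preimages in
  \<open>X\<close> falls below \<open>m\<close> when any \<open>d\<close> is removed. If
  \<open>Y\<close> has \<open>m\<close> elements with values outside \<open>D\<close>, or with
  values in \<open>D - {d}\<close>, the images can be separated; otherwise \<open>Y\<close> is
  concentrated on the fibre of \<open>d\<close>, and then so is \<open>X\<close> or again they
  separate. This serves for chosen neighbours as well as for labels of separated sets.\<close>

lemma split_fibres:
  assumes fin: "finite X" "finite Y" and m: "m \<ge> 1" and c: "3 * m \<le> card X" "3 * m \<le> card Y"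
  obtains (split) S T where "S \<subseteq> X" "T \<subseteq> Y" "card S = m" "card T = m" "f ` S \<inter> f ` T = {}"
  | (fibre) d where "card X \<le> card {x\<in>X. f x = d} + m" "card Y \<le> card {y\<in>Y. f y = d} + 2 * m"
proof -
  have sp: thesis if ST: "S \<subseteq> X" "T \<subseteq> Y" "m \<le> card S" "m \<le> card T" "f ` S \<inter> f ` T = {}" for S T
  proof -
    obtain S' where "S' \<subseteq> S" "card S' = m" by (meson ST(3) obtain_subset_with_card_n)
    moreover obtain T' where "T' \<subseteq> T" "card T' = m" by (meson ST(4) obtain_subset_with_card_n)
    ultimately show ?thesis using split[of S' T'] ST by blast
  qed
  let ?g = "\<lambda>D. card {x\<in>X. f x \<in> D}"
  have "finite (f ` X) \<and> m \<le> ?g (f ` X)"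
  proof -
    have "{x\<in>X. f x \<in> f ` X} = X" by auto
    then show ?thesis using fin c by simp
  qed
  then obtain D where D: "finite D" "m \<le> ?g D" and mn: "\<And>D'. finite D' \<Longrightarrow> m \<le> ?g D' \<Longrightarrow> card D \<le> card D'"
    using ex_has_least_nat[of "\<lambda>D. finite D \<and> m \<le> ?g D" "f ` X" card] by auto
  have "D \<noteq> {}" using D m by auto
  then obtain d where d: "d \<in> D" by auto
  have lt: "?g (D - {d}) < m"
  proof (rule ccontr)
    assume "\<not> ?thesis"
    then have "card D \<le> card (D - {d})" using mn[of "D - {d}"] D by simp
    moreover have "card D > 0" using D d card_gt_0_iff by blast
    ultimately show False using D d by (simp add: card_Diff_singleton)
  qed
  have un: "card Z \<le> card {x\<in>Z. f x \<in> D'} + card {x\<in>Z. f x \<notin> D'}" for Z D'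
  proof -
    have "Z = {x\<in>Z. f x \<in> D'} \<union> {x\<in>Z. f x \<notin> D'}" by auto
    then show ?thesis by (metis (no_types, lifting) card_Un_le)
  qed
  show thesis
  proof (cases "m \<le> card {y\<in>Y. f y \<notin> D}")
    case True
    then show ?thesis using D by (intro sp[of "{x\<in>X. f x \<in> D}" "{y\<in>Y. f y \<notin> D}"]) auto
  next
    case outY: False
    show ?thesis
    proof (cases "m \<le> card {y\<in>Y. f y \<in> D - {d}}")
      case True
      moreover have "m \<le> card {x\<in>X. f x \<notin> D - {d}}" using un[of X "D - {d}"] lt c by linarith
      ultimately show ?thesis
        by (intro sp[of "{x\<in>X. f x \<notin> D - {d}}" "{y\<in>Y. f y \<in> D - {d}}"]) auto
    next
      case False
      have "{y\<in>Y. f y \<in> D} = {y\<in>Y. f y \<in> D - {d}} \<union> {y\<in>Y. f y = d}" using d by auto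
      then have "card {y\<in>Y. f y \<in> D} \<le> card {y\<in>Y. f y \<in> D - {d}} + card {y\<in>Y. f y = d}"
        by (metis (no_types, lifting) card_Un_le)
      then have Yd: "card Y \<le> card {y\<in>Y. f y = d} + 2 * m" using un[of Y D] outY False by linarith
      show ?thesis
      proof (cases "m \<le> card {x\<in>X. f x \<notin> {d}}")
        case True
        then show ?thesis using Yd c
          by (intro sp[of "{x\<in>X. f x \<notin> {d}}" "{y\<in>Y. f y = d}"]) auto
      next
        case False
        then show ?thesis using fibre[of d] Yd un[of X "{d}"] by simp
      qed
    qed
  qed
qed

text \<open>Every \<open>x\<close> in \<open>X \<union> Y\<close> has a chosen neighbour \<open>f x\<close> in \<open>V\<close>. A path with an even number of
vertices inside \<open>(X, Y)\<close> switches the parity. It either closes up directly through a common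
neighbour, or has ends with different neighbours, from which the trees in \<open>Z1\<close> and \<open>Z2\<close> are reached.\<close>

lemma odd_cycle_via_fibres:
  assumes sy: "symp E" and m: "m \<ge> 1" and h: "m \<le> 2 ^ h" "2 ^ h < 2 * m"
    and l: "odd l" "2 * h + 9 \<le> l" "l \<le> m"
    and XY: "joined E m X Y" and finXY: "finite X" "finite Y" and dXY: "X \<inter> Y = {}"
      and cXY: "5 * m \<le> card X" "5 * m \<le> card Y"
    and dis: "A1 \<inter> B1 = {}" "A2 \<inter> B2 = {}" "Z1 \<inter> Z2 = {}" "V \<inter> (Z1 \<union> Z2) = {}" "(X \<union> Y) \<inter> (V \<union> (Z1 \<union> Z2)) = {}"
    and Z1: "expands (cross E A1 B1) m Z1" "finite Z1" "Z1 \<subseteq> A1 \<union> B1"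
    and Z2: "expands (cross E A2 B2) m Z2" "finite Z2" "Z2 \<subseteq> A2 \<union> B2"
    and jn: "joined E m A1 B2" "joined E m B1 A2"
    and V: "\<And>v. v \<in> V \<Longrightarrow> (\<exists>b\<in>Z1 \<inter> B1. E v b) \<and> (\<exists>b\<in>Z2 \<inter> B2. E v b)"
    and f: "\<And>x. x \<in> X \<union> Y \<Longrightarrow> f x \<in> V \<and> E x (f x)"
  shows "cyc E l"
proof -
  obtain k where k: "l = 2 * k + 1" using l(1) by (rule oddE)
  have fE: "E (f x) x" if "x \<in> X \<union> Y" for x using f[OF that] sy by (meson sympD)
  show ?thesis
  proof (rule split_fibres[OF finXY m, of f])
    show "3 * m \<le> card X" "3 * m \<le> card Y" using cXY by auto
  next
    fix d assume d: "card X \<le> card {x\<in>X. f x = d} + m" "card Y \<le> card {y\<in>Y. f y = d} + 2 * m"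
    let ?X = "{x\<in>X. f x = d}" and ?Y = "{y\<in>Y. f y = d}"
    have sub: "?X \<subseteq> X" "?Y \<subseteq> Y" by auto
    have c: "k + 2 * m \<le> card ?X" "k + 2 * m \<le> card ?Y" "k \<ge> 1" using d cXY k l by linarith+
    obtain Q where Q: "length Q = 2 * k" "distinct Q" "successively E Q" "set Q \<subseteq> ?X \<union> ?Y" "hd Q \<in> ?X" "last Q \<in> ?Y"
      using long_path[OF joined_mono[OF XY sub] sy finite_subset[OF sub(1) finXY(1)] finite_subset[OF sub(2) finXY(2)]
        disjoint_mono[OF dXY sub] m c] by blast
    have "d \<in> V" using Q(5) f by auto
    moreover have "set Q \<subseteq> X \<union> Y" using Q(4) by auto
    ultimately have "d \<notin> set Q" using dis(5) by auto
    moreover have "E d (hd Q)" using Q(5) fE[of "hd Q"] by auto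
    moreover have "E (last Q) d" using Q(6) f[of "last Q"] by auto
    moreover have "Q \<noteq> []" using Q(1) c by auto
    ultimately show ?thesis unfolding cyc_def using Q k
      by (intro exI[of _ "d # Q"]) (auto simp: successively_Cons)
  next
    fix S T assume ST: "S \<subseteq> X" "T \<subseteq> Y" "card S = m" "card T = m" "f ` S \<inter> f ` T = {}"
    let ?B = "X - S" and ?A = "Y - T"
    \<comment> \<open>The connecting path \<open>?Q\<close> will have \<open>2 * q + 4\<close>
      vertices and the trees depths \<open>h\<close> and \<open>Suc h\<close>.\<close>
    obtain q where q: "l = 2 * q + 2 * h + 7" "q \<ge> 1"
      using that[of "k - h - 3"] l(2) k by auto
    have cA: "q + 3 * m \<le> card ?A" "q + 3 * m \<le> card ?B"
      using cXY ST finXY q l by (auto simp: card_Diff_subset finite_subset)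
    have jYX: "joined E m Y X" using joined_sym[OF XY sy] .
    obtain s Q t where Q: "length Q = 2 * q" "distinct Q" "successively E Q" "set Q \<subseteq> ?A \<union> ?B"
      "s \<in> S" "t \<in> T" "E s (hd Q)" "E (last Q) t"
    proof (rule attached_path[of E m ?A ?B q S T])
      show "joined E m ?A ?B" by (rule joined_mono[OF jYX]) auto
      show "joined E m S ?A" by (rule joined_mono[OF XY ST(1)]) auto
      show "joined E m T ?B" by (rule joined_mono[OF jYX ST(2)]) auto
      show "?A \<inter> ?B = {}" "S \<inter> ?A = {}" "T \<inter> ?B = {}" using dXY ST by auto
    qed (use sy finXY m q cA ST in auto)
    have st: "s \<in> X \<union> Y" "t \<in> X \<union> Y" using Q(5,6) ST by auto
    have fs: "f s \<in> V" "f t \<in> V" "E (f s) s" "E t (f t)" using f[OF st(1)] f[OF st(2)] fE[OF st(1)] by auto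
    have ne: "f s \<noteq> f t" using Q(5,6) ST(5) by blast
    obtain r1 where r1: "r1 \<in> Z1 \<inter> B1" "E (f s) r1" using V[OF fs(1)] by blast
    obtain r2 where r2: "r2 \<in> Z2 \<inter> B2" "E (f t) r2" using V[OF fs(2)] by blast
    let ?Q = "f s # s # Q @ [t, f t]"
    have Qne: "Q \<noteq> []" using Q q by auto
    have sQ: "s \<notin> set Q" "t \<notin> set Q" "s \<noteq> t" using Q(4,5,6) ST dXY by auto
    have QXY: "set Q \<subseteq> X \<union> Y" using Q(4) by auto
    have VXY: "v \<notin> X \<union> Y" if "v \<in> V" for v using dis(5) that by auto
    \<comment> \<open>Both roots lie on the \<open>B\<close> sides, so the depths must differ in
      parity for the leaves to land on opposite sides. This makes the total length odd.\<close>
    let ?C = "if even h then B1 else A1" and ?D = "if even h then A2 else B2"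
    have "cyc E (h + Suc h + 2 + length ?Q)"
    proof (rule cycle_through_trees[OF sy h _ _ Z1(1,2) _ Z2(1,2) _ dis(3), where C = ?C and D = ?D])
      show "r1 \<in> Z1" "r2 \<in> Z2" using r1 r2 by auto
      have "set ?Q \<subseteq> V \<union> (X \<union> Y)" using fs st QXY by auto
      moreover have "(V \<union> (X \<union> Y)) \<inter> (Z1 \<union> Z2) = {}" using dis(4,5) by auto
      ultimately show "set ?Q \<inter> (Z1 \<union> Z2) = {}" by blast
      have "f s \<notin> set Q" "f t \<notin> set Q" "f s \<noteq> s" "f s \<noteq> t" "f t \<noteq> s" "f t \<noteq> t"
        using VXY[OF fs(1)] VXY[OF fs(2)] QXY st by auto
      then show "distinct ?Q" using Q(2) sQ ne by auto
      show "successively E ?Q" using Q(3,7,8) fs Qne by (auto simp: successively_append_iff successively_Cons hd_append)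
      show "E r1 (hd ?Q)" using r1 sy by (auto dest: sympD)
      show "E (last ?Q) r2" using r2 by simp
      have cr: "cross E A1 B1 = cross E B1 A1" "cross E A2 B2 = cross E B2 A2" by (auto simp: cross_def fun_eq_iff)
      show "y \<in> ?C" if "path (cross E A1 B1) r1 p y" "length p = Suc h" for p y
        using cross_path_end[of E B1 A1 r1 p y h] that dis(1) r1 cr by (auto simp: Int_commute)
      show "y \<in> ?D" if "path (cross E A2 B2) r2 p y" "length p = Suc (Suc h)" for p y
        using cross_path_end[of E B2 A2 r2 p y "Suc h"] that dis(2) r2 cr by (auto simp: Int_commute)
      show "joined E m (Z1 \<inter> ?C) (Z2 \<inter> ?D)"
        using joined_mono[OF jn(1), of "Z1 \<inter> A1" "Z2 \<inter> B2"] joined_mono[OF jn(2), of "Z1 \<inter> B1" "Z2 \<inter> A2"] by auto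
    qed (auto simp: cross_def)
    moreover have "h + Suc h + 2 + length ?Q = l" using q(1) Q(1) by simp
    ultimately show ?thesis by simp
  qed
qed

lemma partition_cards:
  assumes "sum_list ns \<le> card A"
  obtains As where "length As = length ns" "\<And>i. i < length ns \<Longrightarrow> As ! i \<subseteq> A \<and> card (As ! i) = ns ! i"
    "\<And>i j. i < j \<Longrightarrow> j < length ns \<Longrightarrow> As ! i \<inter> As ! j = {}"
proof -
  have "\<exists>As. length As = length ns \<and> (\<forall>i<length ns. As ! i \<subseteq> A \<and> card (As ! i) = ns ! i) \<and>
    (\<forall>j<length ns. \<forall>i<j. As ! i \<inter> As ! j = {})"
    using assms
  proof (induction ns arbitrary: A)
    case (Cons n ns)
    have "n + sum_list ns \<le> card A" using Cons.prems by simp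
    then obtain A1 A2 where A: "A1 \<subseteq> A" "A2 \<subseteq> A" "A1 \<inter> A2 = {}" "card A1 = n" "sum_list ns \<le> card A2"
      by (rule split_card) blast
    from Cons.IH[OF A(5)] obtain As where As: "length As = length ns"
      "\<forall>i<length ns. As ! i \<subseteq> A2 \<and> card (As ! i) = ns ! i" "\<forall>j<length ns. \<forall>i<j. As ! i \<inter> As ! j = {}"
      by blast
    have "\<forall>i<length ns. As ! i \<subseteq> A \<and> card (As ! i) = ns ! i" using As(2) A(2) by blast
    then have "\<forall>i<length (n # ns). (A1 # As) ! i \<subseteq> A \<and> card ((A1 # As) ! i) = (n # ns) ! i"
      using A(1,4) by (auto simp: nth_Cons split: nat.splits)
    moreover have "\<forall>j<length (n # ns). \<forall>i<j. (A1 # As) ! i \<inter> (A1 # As) ! j = {}"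
    proof (intro allI impI)
      fix j i assume "j < length (n # ns)" "i < j"
      then obtain j' where j': "j = Suc j'" "j' < length ns" by (cases j) auto
      show "(A1 # As) ! i \<inter> (A1 # As) ! j = {}"
      proof (cases i)
        case 0
        have "As ! j' \<subseteq> A2" using As(2) j' by blast
        then show ?thesis using A(3) 0 j' by auto
      next
        case (Suc i')
        then show ?thesis using As(3) j' \<open>i < j\<close> by auto
      qed
    qed
    ultimately show ?case using As(1) by (intro exI[of _ "A1 # As"]) simp
  qed simp
  then show ?thesis using that by blast
qed

text \<open>\<open>B\<close> is drawn from the vertices of \<open>X\<close> that see both of two
  expanders inside \<open>X\<close> and \<open>Y\<close>. If it had \<open>p\<close> neighbours in
  \<open>R\<close>, a second joined pair among them would reach both expanders through
  \<open>B\<close> and close a cycle of length \<open>l\<close>.\<close>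

lemma subset_with_few_nbrs:
  assumes sy: "symp E" and m: "m \<ge> 1" and l: "odd l" "2 * K + 1 \<le> l" "l \<le> m"
    and nc: "\<not> cyc E l"
    and XY: "joined E m X Y" "finite X" "finite Y" "X \<inter> Y = {}" "card X = 46 * m" "card Y = 46 * m" "card X \<le> 2 ^ K"
    and finR: "finite R"
    and P: "\<And>P. P \<subseteq> R \<Longrightarrow> p \<le> card P \<Longrightarrow> \<exists>X3 Y3. X3 \<subseteq> P \<and> Y3 \<subseteq> P \<and> X3 \<inter> Y3 = {} \<and>
         card X3 = 5 * m \<and> card Y3 = 5 * m \<and> joined E m X3 Y3"
    and R: "R \<inter> (X \<union> Y) = {}"
  obtains B where "B \<subseteq> X" "card B = 10 * m" "card (nbrs E B R) < p"
proof -
  obtain h where h: "m \<le> 2 ^ h" "2 ^ h < 2 * m" using obtain_depth[OF m] by blast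
  have hK: "h + 4 \<le> K" using depth_bound[OF h(2), of 4 K] XY by simp
  have hl: "2 * h + 9 \<le> l" using hK l by linarith
  \<comment> \<open>\<open>X\<close> supplies one side of each of the two expanders and a reserve
    \<open>A0\<close> of \<open>12 * m\<close> vertices.\<close>
  obtain As where "length As = length [17 * m, 17 * m, 12 * m]" 
    and As: "\<And>i. i < length [17 * m, 17 * m, 12 * m] \<Longrightarrow> As ! i \<subseteq> X \<and> card (As ! i) = [17 * m, 17 * m, 12 * m] ! i"
     "\<And>i j. i < j \<Longrightarrow> j < length [17 * m, 17 * m, 12 * m] \<Longrightarrow> As ! i \<inter> As ! j = {}"
    by (rule partition_cards[of "[17 * m, 17 * m, 12 * m]" X]) (use XY in auto)
  define A1 A2 A0 where "A1 = As ! 0" and "A2 = As ! 1" and "A0 = As ! 2"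
  have A: "A1 \<subseteq> X" "A2 \<subseteq> X" "A0 \<subseteq> X" "card A1 = 17 * m" "card A2 = 17 * m" "card A0 = 12 * m"
    "A1 \<inter> A2 = {}" "A1 \<inter> A0 = {}" "A2 \<inter> A0 = {}"
    using As(1)[of 0] As(1)[of 1] As(1)[of 2] As(2)[of 0 1] As(2)[of 0 2] As(2)[of 1 2]
    unfolding A1_def A2_def A0_def by auto
  have "17 * m + 17 * m \<le> card Y" using XY by simp
  then obtain B1 B2' where B': "B1 \<subseteq> Y" "B2' \<subseteq> Y" "B1 \<inter> B2' = {}" "card B1 = 17 * m" "17 * m \<le> card B2'"
    by (rule split_card) blast
  obtain B2 where B2: "B2 \<subseteq> B2'" "card B2 = 17 * m" by (meson B'(5) obtain_subset_with_card_n)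
  have B: "B1 \<subseteq> Y" "B2 \<subseteq> Y" "B1 \<inter> B2 = {}" using B' B2 by auto
  have fins: "finite A1" "finite A2" "finite A0" "finite B1" "finite B2"
    using A(1-3) B(1,2) XY(2,3) finite_subset by blast+
  have disj: "A1 \<inter> B1 = {}" "A2 \<inter> B2 = {}" 
    using disjoint_mono[OF XY(4) A(1) B(1)] disjoint_mono[OF XY(4) A(2) B(2)] .
  have jXY: "joined E m C D" "joined E m D C" if "C \<subseteq> X" "D \<subseteq> Y" for C D
    using joined_mono[OF XY(1) that] joined_sym[OF _ sy] by auto
  obtain Z1 where Z1: "Z1 \<subseteq> A1 \<union> B1" "card (A1 \<union> B1 - Z1) < 2 * m" "expands (cross E A1 B1) m Z1"
    using expander_bipartite[OF jXY(1)[OF A(1) B(1)] sy fins(1,4) disj(1) m] A B' by auto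
  obtain Z2 where Z2: "Z2 \<subseteq> A2 \<union> B2" "card (A2 \<union> B2 - Z2) < 2 * m" "expands (cross E A2 B2) m Z2"
    using expander_bipartite[OF jXY(1)[OF A(2) B(2)] sy fins(2,5) disj(2) m] A B2 by auto
  have cZ: "m \<le> card (Z1 \<inter> B1)" "m \<le> card (Z2 \<inter> B2)"
    using large_Int[OF Z1(2), of B1] large_Int[OF Z2(2), of B2] B' B2 fins by auto
  let ?N1 = "nbrs E (Z1 \<inter> B1) A0" and ?N2 = "nbrs E (Z2 \<inter> B2) A0"
  have dA0: "Z1 \<inter> B1 \<inter> A0 = {}" "Z2 \<inter> B2 \<inter> A0 = {}" using A(3) B XY(4) by auto
  have n1: "card (A0 - ?N1) < m"
    using B by (intro joined_non_nbrs[OF jXY(2)[OF A(3) B(1)] _ cZ(1) dA0(1)]) auto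
  have n2: "card (A0 - ?N2) < m"
    using B by (intro joined_non_nbrs[OF jXY(2)[OF A(3) B(2)] _ cZ(2) dA0(2)]) auto
  \<comment> \<open>Each expander is missed by fewer than \<open>m\<close> vertices of
    \<open>A0\<close>, so at least \<open>10 * m\<close> see both.\<close>
  have "A0 \<subseteq> (?N1 \<inter> ?N2) \<union> (A0 - ?N1) \<union> (A0 - ?N2)" by auto
  then have "card A0 \<le> card ((?N1 \<inter> ?N2) \<union> (A0 - ?N1) \<union> (A0 - ?N2))"
    using fins by (intro card_mono) (auto simp: nbrs_def)
  also have "\<dots> \<le> card (?N1 \<inter> ?N2) + card (A0 - ?N1) + card (A0 - ?N2)"
    by (meson add_le_mono1 card_Un_le le_trans)
  finally have "10 * m \<le> card (?N1 \<inter> ?N2)" using n1 n2 A(6) by linarith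
  then obtain V where V: "V \<subseteq> ?N1 \<inter> ?N2" "card V = 10 * m" by (meson obtain_subset_with_card_n)
  have VA: "V \<subseteq> A0" using V unfolding nbrs_def by auto
  have "card (nbrs E V R) < p"
  proof (rule ccontr)
    assume "\<not> ?thesis"
    moreover have NR: "nbrs E V R \<subseteq> R" unfolding nbrs_def by auto
    ultimately obtain X3 Y3 where X3: "X3 \<subseteq> nbrs E V R" "Y3 \<subseteq> nbrs E V R" "X3 \<inter> Y3 = {}"
      "card X3 = 5 * m" "card Y3 = 5 * m" "joined E m X3 Y3" using P[of "nbrs E V R"] by auto
    define f where "f x = (SOME v. v \<in> V \<and> E x v)" for x
    have f: "f x \<in> V \<and> E x (f x)" if "x \<in> X3 \<union> Y3" for x
    proof -
      have "\<exists>v\<in>V. E v x" using that X3(1,2) unfolding nbrs_def by auto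
      then have "\<exists>v. v \<in> V \<and> E x v" using sy by (meson sympD)
      then show ?thesis unfolding f_def by (rule someI_ex)
    qed
    have ZXY: "Z1 \<union> Z2 \<subseteq> X \<union> Y" "V \<subseteq> X \<union> Y" using Z1(1) Z2(1) A(1-3) B VA by auto
    have "cyc E l"
    proof (rule odd_cycle_via_fibres[OF sy m h l(1) hl l(3) X3(6) _ _ X3(3) _ _ disj _ _ _ Z1(3) _ Z1(1) Z2(3) _ Z2(1) _ _ _ f])
      show "finite X3" "finite Y3" using X3(1,2) NR finR by (meson finite_subset)+
      show "5 * m \<le> card X3" "5 * m \<le> card Y3" using X3 by auto
      show "Z1 \<inter> Z2 = {}"
      proof (rule disjoint_mono[OF _ Z1(1) Z2(1)])
        show "(A1 \<union> B1) \<inter> (A2 \<union> B2) = {}"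
          using A(7) B(3) disjoint_mono[OF XY(4) A(1) B(2)] disjoint_mono[OF XY(4) A(2) B(1)]
          by (simp add: Int_Un_distrib Int_Un_distrib2 Int_commute)
      qed
      show "V \<inter> (Z1 \<union> Z2) = {}"
      proof (rule disjoint_mono[OF _ VA Un_mono[OF Z1(1) Z2(1)]])
        show "A0 \<inter> (A1 \<union> B1 \<union> (A2 \<union> B2)) = {}"
          using A(8,9) disjoint_mono[OF XY(4) A(3) B(1)] disjoint_mono[OF XY(4) A(3) B(2)]
          by (simp add: Int_Un_distrib Int_Un_distrib2 Int_commute)
      qed
      have "X3 \<union> Y3 \<subseteq> R" using X3(1,2) NR by blast
      then show "(X3 \<union> Y3) \<inter> (V \<union> (Z1 \<union> Z2)) = {}"
        using disjoint_mono[OF R, of "X3 \<union> Y3" "V \<union> (Z1 \<union> Z2)"] ZXY by simp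
      show "finite Z1" "finite Z2" using Z1(1) Z2(1) fins by (meson finite_subset finite_UnI)+
      show "joined E m A1 B2" "joined E m B1 A2" using jXY A B by auto
      show "(\<exists>b\<in>Z1 \<inter> B1. E v b) \<and> (\<exists>b\<in>Z2 \<inter> B2. E v b)" if "v \<in> V" for v
      proof -
        have "v \<in> ?N1" "v \<in> ?N2" using that V by auto
        then show ?thesis using sy unfolding nbrs_def by (auto dest: sympD)
      qed
    qed
    then show False using nc by simp
  qed
  moreover have "V \<subseteq> X" using VA A by auto
  ultimately show ?thesis using that[of V] V by blast
qed

section \<open>Removing colours\<close>

definition hole :: "(('a \<Rightarrow> 'a \<Rightarrow> bool) \<times> nat) list \<Rightarrow> nat \<Rightarrow> 'a set \<Rightarrow> 'a set \<Rightarrow> bool" where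
  "hole ps m X Y \<longleftrightarrow> X \<inter> Y = {} \<and> card X = m \<and> card Y = m \<and> (\<forall>(E, l)\<in>set ps. \<forall>x\<in>X. \<forall>y\<in>Y. \<not> E x y)"

lemma hole_no_edge: "hole ps m X Y \<Longrightarrow> (E, l) \<in> set ps \<Longrightarrow> x \<in> X \<Longrightarrow> y \<in> Y \<Longrightarrow> \<not> E x y"
  unfolding hole_def by fastforce

lemma hole_subset:
  assumes "hole ps s X Y" "X' \<subseteq> X" "Y' \<subseteq> Y" "card X' = m" "card Y' = m"
    "\<And>x y. x \<in> X' \<Longrightarrow> y \<in> Y' \<Longrightarrow> \<not> E x y"
  shows "hole ((E, l) # ps) m X' Y'"
  using assms disjoint_mono[of X Y X' Y'] unfolding hole_def by fastforce

text \<open>Two disjoint \<open>m\<close>-subsets without an \<open>E\<close>-edge would themselves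
  be a hole for the longer list.\<close>

lemma hole_joined:
  assumes "hole ps s X Y" "X \<subseteq> W" "Y \<subseteq> W" "\<And>X Y. X \<subseteq> W \<Longrightarrow> Y \<subseteq> W \<Longrightarrow> \<not> hole ((E, l) # ps) m X Y"
  shows "joined E m X Y"
  unfolding joined_def
proof (intro allI impI, rule ccontr)
  fix X' Y' assume "X' \<subseteq> X" "Y' \<subseteq> Y" "card X' = m" "card Y' = m" and no: "\<not> (\<exists>x\<in>X'. \<exists>y\<in>Y'. E x y)"
  then have "hole ((E, l) # ps) m X' Y'" by (intro hole_subset[OF assms(1)]) auto
  moreover have "X' \<subseteq> W" "Y' \<subseteq> W" using \<open>X' \<subseteq> X\<close> \<open>Y' \<subseteq> Y\<close> assms(2,3) by auto
  ultimately show False using assms(4) by blast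
qed

text \<open>\<open>D\<close> is the union of \<open>j\<close> blobs of size \<open>10 * m\<close>, which are the fibres of \<open>f\<close>, and \<open>R\<close> is what
remains of \<open>W\<close>. A new blob costs the pair \<open>(X, Y)\<close>, which is \<open>92 * m\<close> vertices, and fewer than \<open>5 * F * m\<close>
neighbours; finding the pair takes a remainder of \<open>46 * F * m\<close> vertices.\<close>

lemma separated_family:
  assumes sy: "symp E" and m: "m \<ge> 1" and l: "odd l" "2 * K + 1 \<le> l" "l \<le> m" and nc: "\<not> cyc E l"
    and W: "finite W" "card W \<le> 2 ^ K"
    and IH: "\<And>R s. R \<subseteq> W \<Longrightarrow> F * s \<le> card R \<Longrightarrow> m \<le> s \<Longrightarrow> \<exists>X Y. X \<subseteq> R \<and> Y \<subseteq> R \<and> hole qs s X Y"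
    and nh: "\<And>X Y. X \<subseteq> W \<Longrightarrow> Y \<subseteq> W \<Longrightarrow> \<not> hole ((E, l) # qs) m X Y"
    and F: "F \<ge> 1"
    and j: "(j * (92 + 5 * F) + 46 * F) * m \<le> card W"
  shows "\<exists>D (f :: 'a \<Rightarrow> nat) R. D \<subseteq> W \<and> R \<subseteq> W \<and> D \<inter> R = {} \<and> card D = j * (10 * m) \<and> f ` D \<subseteq> {..<j} \<and>
     (\<forall>i. card {x\<in>D. f x = i} \<le> 10 * m) \<and> (\<forall>x\<in>D. \<forall>y\<in>D. f x \<noteq> f y \<longrightarrow> \<not> E x y) \<and>
     (\<forall>x\<in>D. \<forall>y\<in>R. \<not> E x y) \<and> card W \<le> card R + j * (92 + 5 * F) * m"
  using j
proof (induction j)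
  case 0
  show ?case by (rule exI[of _ "{}"], rule exI[of _ "\<lambda>_. 0"], rule exI[of _ W]) simp
next
  case (Suc j)
  then obtain D f R where D: "D \<subseteq> W" "R \<subseteq> W" "D \<inter> R = {}" "card D = j * (10 * m)" "f ` D \<subseteq> {..<j}"
    "\<forall>i. card {x\<in>D. f x = i} \<le> 10 * m" "\<forall>x\<in>D. \<forall>y\<in>D. f x \<noteq> f y \<longrightarrow> \<not> E x y"
    "\<forall>x\<in>D. \<forall>y\<in>R. \<not> E x y" "card W \<le> card R + j * (92 + 5 * F) * m"
    by (auto simp: algebra_simps)
  have "F * (46 * m) \<le> card R" using Suc.prems D(9) by (simp add: algebra_simps)
  then obtain X Y where XY: "X \<subseteq> R" "Y \<subseteq> R" "hole qs (46 * m) X Y"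
    using IH[of R "46 * m"] D(2) by auto
  have XYW: "X \<subseteq> W" "Y \<subseteq> W" using XY D(2) by auto
  have finXY: "finite X" "finite Y" "finite R" "finite D" using XYW W(1) D(1,2) by (meson finite_subset)+
  have h: "X \<inter> Y = {}" "card X = 46 * m" "card Y = 46 * m" using XY(3) unfolding hole_def by auto
  have jXY: "joined E m X Y" using hole_joined[OF XY(3) XYW nh] .
  let ?R = "R - (X \<union> Y)"
  obtain B where B: "B \<subseteq> X" "card B = 10 * m" "card (nbrs E B ?R) < 5 * F * m"
  proof (rule subset_with_few_nbrs[OF sy m l nc jXY finXY(1,2) h, of ?R "5 * F * m"])
    show "card X \<le> 2 ^ K" using card_mono[OF W(1) XYW(1)] W(2) by simp
    fix P assume P: "P \<subseteq> ?R" "5 * F * m \<le> card P"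
    have PW: "P \<subseteq> W" using P D by auto
    have "F * (5 * m) \<le> card P" using P(2) by (simp add: algebra_simps)
    then obtain X3 Y3 where 3: "X3 \<subseteq> P" "Y3 \<subseteq> P" "hole qs (5 * m) X3 Y3"
      using IH[OF PW, of "5 * m"] by auto
    moreover have "joined E m X3 Y3" using hole_joined[OF 3(3) _ _ nh] 3 PW by auto
    ultimately show "\<exists>X3 Y3. X3 \<subseteq> P \<and> Y3 \<subseteq> P \<and> X3 \<inter> Y3 = {} \<and>
         card X3 = 5 * m \<and> card Y3 = 5 * m \<and> joined E m X3 Y3" unfolding hole_def by blast
  qed (use finXY in auto)
  let ?N = "nbrs E B ?R"
  let ?D = "D \<union> B" and ?f = "\<lambda>x. if x \<in> B then j else f x"
  have BR: "B \<subseteq> R" using B XY by auto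
  then have dDB: "D \<inter> B = {}" using D(3) by auto
  have finB: "finite B" using BR finXY finite_subset by blast
  have fD: "f x < j" if "x \<in> D" for x using D(5) that by auto
  show ?case
  proof (intro exI conjI)
    show "?D \<subseteq> W" "?R - ?N \<subseteq> W" using D BR by auto
    show "?D \<inter> (?R - ?N) = {}" using D(3) B(1) by auto
    show "card ?D = Suc j * (10 * m)" using D(4) B(2) dDB finXY finB by (simp add: card_Un_disjoint)
    show "?f ` ?D \<subseteq> {..<Suc j}" using fD by (auto simp: less_Suc_eq)
    show "\<forall>i. card {x\<in>?D. ?f x = i} \<le> 10 * m"
    proof
      fix i
      show "card {x\<in>?D. ?f x = i} \<le> 10 * m"
      proof (cases "i = j")
        case True
        then have "{x\<in>?D. ?f x = i} = B" by (auto dest: fD)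
        then show ?thesis using B(2) by simp
      next
        case False
        then have "{x\<in>?D. ?f x = i} \<subseteq> {x\<in>D. f x = i}" by auto
        then have "card {x\<in>?D. ?f x = i} \<le> card {x\<in>D. f x = i}" using finXY by (intro card_mono) auto
        then show ?thesis using D(6) le_trans by blast
      qed
    qed
    \<comment> \<open>\<open>B\<close> lies in \<open>R\<close>, to which the earlier blobs send no
      edges.\<close>
    have DB: "\<not> E x y" "\<not> E y x" if "x \<in> D" "y \<in> B" for x y using that D(8) BR sy by (auto dest: sympD)
    show "\<forall>x\<in>?D. \<forall>y\<in>?D. ?f x \<noteq> ?f y \<longrightarrow> \<not> E x y"
      using D(7) DB by auto
    show "\<forall>x\<in>?D. \<forall>y\<in>?R - ?N. \<not> E x y" using D(8) unfolding nbrs_def by auto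
    have "R = (?R - ?N) \<union> X \<union> Y \<union> ?N" using XY(1,2) unfolding nbrs_def by auto
    then have "card R = card ((?R - ?N) \<union> X \<union> Y \<union> ?N)" by (rule arg_cong)
    then have "card R \<le> card (?R - ?N) + card X + card Y + card ?N"
      using card_Un_le[of "(?R - ?N) \<union> X \<union> Y" ?N] card_Un_le[of "(?R - ?N) \<union> X" Y] card_Un_le[of "?R - ?N" X]
      by linarith
    then show "card W \<le> card (?R - ?N) + Suc j * (92 + 5 * F) * m"
      using D(9) h B(3) by (simp add: algebra_simps)
  qed
qed

text \<open>The ratio of \<open>card W\<close> to \<open>m\<close> that suffices for
  \<open>k\<close> odd colours: with none, two disjoint \<open>m\<close>-sets have to fit; with one,
  the exponent is 0 and 41 is the constant of \<open>odd_cycle_in_joined\<close>.\<close>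

definition odd_ratio :: "nat \<Rightarrow> nat" where
  "odd_ratio k = (if k = 0 then 2 else 41 * 35 ^ (2 ^ k - 2))"

lemma odd_ratio_ge: "2 \<le> odd_ratio k"
proof -
  have "41 * 1 \<le> 41 * (35::nat) ^ (2 ^ k - 2)" by (intro mult_le_mono) auto
  then have "2 \<le> 41 * (35::nat) ^ (2 ^ k - 2)" by linarith
  then show ?thesis unfolding odd_ratio_def by simp
qed

lemma odd_ratio_Suc:
  assumes "k \<ge> 1"
  shows "odd_ratio k * (92 + 5 * odd_ratio k) + 46 * odd_ratio k \<le> odd_ratio (Suc k)"
proof -
  let ?F = "odd_ratio k"
  define e where "e = (2::nat) ^ k - 2"
  have "(2::nat) ^ 1 \<le> 2 ^ k" using assms by (intro power_increasing) auto
  then have "(2::nat) ^ Suc k - 2 = e + e + 2" unfolding e_def by simp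
  then have S: "odd_ratio (Suc k) = 41 * (35 ^ e * 35 ^ e * 1225)" unfolding odd_ratio_def by (simp add: power_add)
  have F: "?F = 41 * 35 ^ e" using assms unfolding odd_ratio_def e_def by simp
  define u where "u = (35::nat) ^ e"
  have u1: "1 \<le> u" unfolding u_def by simp
  \<comment> \<open>With \<open>F = 41 * u\<close> the left side is
    \<open>8405 * u * u + 5658 * u\<close>, against \<open>50225 * u * u\<close> on the
    right.\<close>
  have "u \<le> u * u" using u1 by simp
  then show ?thesis unfolding S F u_def[symmetric] by (simp add: algebra_simps)
qed

text \<open>\<open>m\<close> is kept arbitrary in the induction because the shorter list is applied
  with the larger sizes \<open>46 * m\<close>, \<open>5 * m\<close> and
  \<open>10 * m\<close>.\<close>

lemma odd_colours_hole:
  assumes "\<And>E l. (E, l) \<in> set ps \<Longrightarrow> symp E \<and> odd l \<and> 2 * K + 1 \<le> l \<and> l \<le> m \<and> \<not> cyc E l"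
    and "finite W" "card W \<le> 2 ^ K" "odd_ratio (length ps) * m \<le> card W" "m \<ge> 1"
  shows "\<exists>X Y. X \<subseteq> W \<and> Y \<subseteq> W \<and> hole ps m X Y"
  using assms
proof (induction ps arbitrary: W m)
  case Nil
  then have "m + m \<le> card W" by (simp add: odd_ratio_def)
  then obtain A1 A2 where "A1 \<subseteq> W" "A2 \<subseteq> W" "A1 \<inter> A2 = {}" "card A1 = m" "m \<le> card A2"
    by (rule split_card) blast
  moreover obtain A3 where "A3 \<subseteq> A2" "card A3 = m" by (meson calculation(5) obtain_subset_with_card_n)
  ultimately show ?case unfolding hole_def by (intro exI[of _ A1] exI[of _ A3]) auto
next
  case (Cons a qs)
  obtain E l where a: "a = (E, l)" by fastforce
  have El: "symp E" "odd l" "2 * K + 1 \<le> l" "l \<le> m" "\<not> cyc E l" using Cons.prems(1)[of E l] a by auto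
  show ?case
  proof (rule ccontr)
    assume "\<not> ?thesis"
    then have nh: "\<not> hole ((E, l) # qs) m X Y" if "X \<subseteq> W" "Y \<subseteq> W" for X Y using a that by blast
    show False
    proof (cases "qs = []")
      case True
      have "joined E m W W"
        unfolding joined_def
      proof (intro allI impI, rule ccontr)
        fix X Y assume "X \<subseteq> W" "Y \<subseteq> W" "card X = m" "card Y = m" "X \<inter> Y = {}" "\<not> (\<exists>x\<in>X. \<exists>y\<in>Y. E x y)"
        then show False using nh[of X Y] True unfolding hole_def by auto
      qed
      moreover have "41 * m \<le> card W" using Cons.prems(4) True by (simp add: odd_ratio_def)
      ultimately have "cyc E l" using odd_cycle_in_joined El Cons.prems(2,3,5) by blast
      then show False using El by simp
    next
      case False
      define F where "F = odd_ratio (length qs)"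
      have IH: "\<exists>X Y. X \<subseteq> R \<and> Y \<subseteq> R \<and> hole qs s X Y" if "R \<subseteq> W" "F * s \<le> card R" "m \<le> s" for R s
      proof (rule Cons.IH)
        show "symp E \<and> odd l \<and> 2 * K + 1 \<le> l \<and> l \<le> s \<and> \<not> cyc E l" if "(E, l) \<in> set qs" for E l
          using Cons.prems(1)[of E l] that \<open>m \<le> s\<close> by auto
        show "finite R" "card R \<le> 2 ^ K" using that Cons.prems(2,3) 
          by (meson finite_subset card_mono le_trans)+
        show "odd_ratio (length qs) * s \<le> card R" using that unfolding F_def by simp
        show "1 \<le> s" using that Cons.prems(5) by simp
      qed
      have "length qs \<ge> 1" using False by (simp add: Suc_le_eq)
      then have "(F * (92 + 5 * F) + 46 * F) * m \<le> odd_ratio (length (a # qs)) * m"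
        using odd_ratio_Suc[of "length qs"] unfolding F_def by (intro mult_le_mono1) simp
      then have "(F * (92 + 5 * F) + 46 * F) * m \<le> card W" using Cons.prems(4) by (rule le_trans)
      moreover have "F \<ge> 1" unfolding F_def odd_ratio_def by simp
      \<comment> \<open>\<open>F\<close> blobs of size \<open>10 * m\<close> make \<open>D\<close>
        just large enough to contain a hole of size \<open>10 * m\<close> for the remaining
        colours.\<close>
      ultimately obtain D and f :: "'a \<Rightarrow> nat" where D: "D \<subseteq> W" "card D = F * (10 * m)"
        "\<forall>i. card {x\<in>D. f x = i} \<le> 10 * m" "\<forall>x\<in>D. \<forall>y\<in>D. f x \<noteq> f y \<longrightarrow> \<not> E x y"
        using separated_family[OF El(1) Cons.prems(5) El(2-5) Cons.prems(2,3) IH nh, of F F] by blast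
      obtain X Y where XY: "X \<subseteq> D" "Y \<subseteq> D" "hole qs (10 * m) X Y" using IH[of D "10 * m"] D by auto
      have h: "X \<inter> Y = {}" "card X = 10 * m" "card Y = 10 * m" using XY(3) unfolding hole_def by auto
      have fin: "finite D" "finite X" "finite Y" using D(1) XY Cons.prems(2) by (meson finite_subset)+
      show False
      proof (rule split_fibres[OF fin(2,3) Cons.prems(5), of f])
        show "3 * m \<le> card X" "3 * m \<le> card Y" using h by auto
      next
        fix S T assume ST: "S \<subseteq> X" "T \<subseteq> Y" "card S = m" "card T = m" "f ` S \<inter> f ` T = {}"
        have "hole ((E, l) # qs) m S T"
        proof (rule hole_subset[OF XY(3) ST(1-4)])
          fix x y assume xy: "x \<in> S" "y \<in> T"
          then have "f x \<noteq> f y" using ST(5) by blast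
          moreover have "x \<in> D" "y \<in> D" using xy ST XY by auto
          ultimately show "\<not> E x y" using D(4) by blast
        qed
        moreover have "S \<subseteq> W" "T \<subseteq> W" using ST XY D by auto
        ultimately show False using nh by blast
      next
        fix d assume d: "card X \<le> card {x\<in>X. f x = d} + m" "card Y \<le> card {y\<in>Y. f y = d} + 2 * m"
        \<comment> \<open>A single blob would have to contain at least \<open>9 * m\<close> vertices
          of \<open>X\<close> and \<open>8 * m\<close> of \<open>Y\<close>, but it has at most
          \<open>10 * m\<close>.\<close>
        have "{x\<in>X. f x = d} \<inter> {y\<in>Y. f y = d} = {}" using h(1) by auto
        then have "card {x\<in>X. f x = d} + card {y\<in>Y. f y = d} = card ({x\<in>X. f x = d} \<union> {y\<in>Y. f y = d})"
          using fin by (simp add: card_Un_disjoint)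
        also have "\<dots> \<le> card {x\<in>D. f x = d}" using XY fin by (intro card_mono) auto
        also have "\<dots> \<le> 10 * m" using D(3) by blast
        finally show False using d h Cons.prems(5) by linarith
      qed
    qed
  qed
qed

text \<open>Each even colour costs a factor 40: a pair joined at the reduced size would contain the
  cycle, so some pair of that size has no edge of this colour, and the remaining colours are removed
  inside it.\<close>

lemma even_colours_hole:
  assumes "\<And>E l. (E, l) \<in> set ps \<Longrightarrow> symp E \<and> even l \<and> 2 * K + 1 \<le> l \<and> l \<le> m \<and> \<not> cyc E l"
    and "finite A" "finite B" "A \<inter> B = {}" "card A \<le> 2 ^ K"
    and "40 ^ length ps * m \<le> card A" "40 ^ length ps * m \<le> card B" "m \<ge> 1"
  shows "\<exists>X Y. X \<subseteq> A \<and> Y \<subseteq> B \<and> hole ps m X Y"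
  using assms
proof (induction ps arbitrary: A B)
  case Nil
  then obtain X Y where "X \<subseteq> A" "card X = m" "Y \<subseteq> B" "card Y = m" by (metis mult_1 obtain_subset_with_card_n power_0 list.size(3))
  then show ?case unfolding hole_def using disjoint_mono[OF Nil(4)] by (intro exI[of _ X] exI[of _ Y]) auto
next
  case (Cons a qs)
  obtain E l where a: "a = (E, l)" by fastforce
  let ?s = "40 ^ length qs * m"
  have El: "symp E" "even l" "2 * K + 1 \<le> l" "l \<le> m" "\<not> cyc E l" using Cons.prems(1)[of E l] a by auto
  have s: "m \<le> ?s" by simp
  have "\<not> joined E ?s A B"
  proof
    assume "joined E ?s A B"
    then have "cyc E l"
      using even_cycle_in_joined[of E ?s A B K l] El Cons.prems(2-8) s by (simp add: mult.assoc)
    then show False using El by simp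
  qed
  then obtain X Y where XY: "X \<subseteq> A" "Y \<subseteq> B" "card X = ?s" "card Y = ?s" "X \<inter> Y = {}" "\<forall>x\<in>X. \<forall>y\<in>Y. \<not> E x y"
    unfolding joined_def by blast
  have "\<exists>X' Y'. X' \<subseteq> X \<and> Y' \<subseteq> Y \<and> hole qs m X' Y'"
  proof (rule Cons.IH)
    show "finite X" "finite Y" using XY Cons.prems(2,3) finite_subset by blast+
    show "card X \<le> 2 ^ K" using card_mono[OF Cons.prems(2) XY(1)] Cons.prems(5) by simp
    show "symp E \<and> even l \<and> 2 * K + 1 \<le> l \<and> l \<le> m \<and> \<not> cyc E l" if "(E, l) \<in> set qs" for E l
      using Cons.prems(1)[of E l] that by auto
  qed (use XY Cons.prems in auto)
  then obtain X' Y' where X': "X' \<subseteq> X" "Y' \<subseteq> Y" "hole qs m X' Y'" by blast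
  then have "hole (a # qs) m X' Y'" unfolding a using XY(6)
    by (intro hole_subset[OF X'(3)]) (auto simp: hole_def)
  then show ?case using X' XY by (intro exI[of _ X'] exI[of _ Y']) auto
qed

section \<open>A sparse host graph\<close>

text \<open>By double counting, some point of \<open>Q\<close> lies in at least the fraction
  \<open>a / b\<close> of the sets not yet hit, so adding it shrinks their number by the factor
  \<open>1 - a / b\<close>.\<close>

lemma greedy_cover:
  fixes P :: "'a set set" and b :: real
  assumes fin: "finite P" "finite Q" and Q: "Q \<noteq> {}" "real (card Q) \<le> b" and ab: "real a \<le> b"
    and P: "\<And>p. p \<in> P \<Longrightarrow> p \<subseteq> Q \<and> a \<le> card p"
  shows "\<exists>S\<subseteq>Q. card S \<le> M \<and> real (card {p\<in>P. p \<inter> S = {}}) \<le> real (card P) * (1 - real a / b) ^ M"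
proof (induction M)
  case 0
  show ?case by (rule exI[of _ "{}"]) simp
next
  case (Suc M)
  then obtain S where S: "S \<subseteq> Q" "card S \<le> M"
    and le: "real (card {p\<in>P. p \<inter> S = {}}) \<le> real (card P) * (1 - real a / b) ^ M" by blast
  let ?R = "{p\<in>P. p \<inter> S = {}}"
  have cQ: "0 < card Q" using Q fin by (simp add: card_gt_0_iff)
  then have b: "0 < b" using Q(2) by linarith
  have "\<exists>q\<in>Q. real a * real (card ?R) / b \<le> real (card {p\<in>?R. q \<in> p})"
  proof (rule ccontr)
    assume neg: "\<not> ?thesis"
    have "(\<Sum>q\<in>Q. real (card {p\<in>?R. q \<in> p})) < (\<Sum>q\<in>Q. real a * real (card ?R) / b)"
      using neg Q fin by (intro sum_strict_mono) (auto simp: not_le)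
    also have "\<dots> = real (card Q) * (real a * real (card ?R) / b)" by simp
    also have "\<dots> \<le> b * (real a * real (card ?R) / b)" using Q(2) b by (intro mult_right_mono) auto
    also have "\<dots> = real (a * card ?R)" using b by simp
    also have "a * card ?R \<le> (\<Sum>p\<in>?R. card {q\<in>Q. q \<in> p})"
    proof -
      have "(\<Sum>p\<in>?R. a) \<le> (\<Sum>p\<in>?R. card {q\<in>Q. q \<in> p})"
      proof (rule sum_mono)
        fix p assume p: "p \<in> ?R"
        then have "{q\<in>Q. q \<in> p} = p" using P[of p] by auto
        then show "a \<le> card {q\<in>Q. q \<in> p}" using P[of p] p by auto
      qed
      then show ?thesis by (simp add: mult.commute)
    qed
    also have "(\<Sum>p\<in>?R. card {q\<in>Q. q \<in> p}) = (\<Sum>q\<in>Q. card {p\<in>?R. q \<in> p})"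
    proof -
      have "(\<Sum>p\<in>?R. card {q\<in>Q. q \<in> p}) = (\<Sum>p\<in>?R. \<Sum>q\<in>Q. if q \<in> p then 1 else 0)"
        using fin by (intro sum.cong) (auto simp: sum.If_cases Int_def)
      also have "\<dots> = (\<Sum>q\<in>Q. \<Sum>p\<in>?R. if q \<in> p then 1 else 0)" by (rule sum.swap)
      also have "\<dots> = (\<Sum>q\<in>Q. card {p\<in>?R. q \<in> p})"
        using fin by (intro sum.cong) (auto simp: sum.If_cases Int_def conj_ac)
      finally show ?thesis .
    qed
    finally show False by simp
  qed
  then obtain q where q: "q \<in> Q" "real a * real (card ?R) / b \<le> real (card {p\<in>?R. q \<in> p})" by blast
  have rest: "{p\<in>P. p \<inter> insert q S = {}} = ?R - {p\<in>?R. q \<in> p}" by auto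
  have "card {p\<in>P. p \<inter> insert q S = {}} = card ?R - card {p\<in>?R. q \<in> p}"
    unfolding rest by (rule card_Diff_subset) (use fin in auto)
  moreover have "card {p\<in>?R. q \<in> p} \<le> card ?R" using fin by (intro card_mono) auto
  ultimately have "real (card {p\<in>P. p \<inter> insert q S = {}}) = real (card ?R) - real (card {p\<in>?R. q \<in> p})"
    by simp
  also have "\<dots> \<le> real (card ?R) * (1 - real a / b)" using q(2) by (simp add: algebra_simps)
  also have "\<dots> \<le> real (card P) * (1 - real a / b) ^ M * (1 - real a / b)"
    using le ab b by (intro mult_right_mono) auto
  finally have "real (card {p\<in>P. p \<inter> insert q S = {}}) \<le> real (card P) * (1 - real a / b) ^ Suc M"
    by (simp add: mult_ac)
  moreover have "card (insert q S) \<le> Suc M" 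
    using S(2) finite_subset[OF S(1) fin(2)] by (simp add: card_insert_if)
  ultimately show ?case using S q by (intro exI[of _ "insert q S"]) auto
qed

text \<open>The factorial is bounded through \<open>n ^ n / fact n\<close>, a single term of the
  exponential series at \<open>n\<close>.\<close>

lemma binomial_le_exp:
  fixes c n :: nat
  assumes "n \<ge> 1" "c \<ge> 1"
  shows "real ((c * n) choose n) \<le> exp (real n * (ln (real c) + 1))"
proof -
  have "real n ^ n / fact n \<le> exp (real n)"
  proof -
    have s: "summable (\<lambda>k. real n ^ k /\<^sub>R fact k)" by (rule summable_exp_generic)
    have "(\<Sum>k\<in>{n}. real n ^ k /\<^sub>R fact k) \<le> (\<Sum>k. real n ^ k /\<^sub>R fact k)"
      by (rule sum_le_suminf[OF s]) auto
    then show ?thesis unfolding exp_def by (simp add: divide_inverse mult.commute)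
  qed
  then have f: "real n ^ n \<le> exp (real n) * fact n" by (simp add: field_simps)
  have "real ((c * n) choose n) * fact n \<le> real (c * n) ^ n"
    using binomial_fact_pow[of "c * n" n] by (metis of_nat_fact of_nat_le_iff of_nat_mult of_nat_power)
  also have "\<dots> = real c ^ n * real n ^ n" by (simp add: power_mult_distrib)
  also have "\<dots> \<le> real c ^ n * (exp (real n) * fact n)" using f by (intro mult_left_mono) auto
  finally have "real ((c * n) choose n) \<le> real c ^ n * exp (real n)" by simp
  also have "real c ^ n = exp (real n * ln (real c))" using assms by (simp add: exp_of_nat_mult)
  also have "exp (real n * ln (real c)) * exp (real n) = exp (real n * (ln (real c) + 1))"
    by (simp add: exp_add[symmetric] algebra_simps)
  finally show ?thesis .
qed

text \<open>In the greedy cover the points are possible edges and the sets are the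
  \<open>n * n\<close> edges between two disjoint \<open>n\<close>-sets. Each set is counted as a
  fraction \<open>2 / c^2\<close> of all edges, and there are at most
  \<open>exp (2 * n * (ln c + 1))\<close> sets, so after \<open>M\<close> steps fewer than one is
  left.\<close>

lemma sparse_joined_graph:
  fixes c n M :: nat
  assumes n: "n \<ge> 1" and c: "c \<ge> 2" and M: "(real c)\<^sup>2 * real n * (ln (real c) + 1) < real M"
  obtains S where "simple_graph S" "card S \<le> M" "joined (\<lambda>x y. {x, y} \<in> S) n {..<c * n} {..<c * n}"
proof -
  let ?V = "{..<c * n}"
  define Q where "Q = {e. e \<subseteq> ?V \<and> card e = 2}"
  define pairs where "pairs = {X. X \<subseteq> ?V \<and> card X = n} \<times> {X. X \<subseteq> ?V \<and> card X = n} \<inter> {(X, Y). X \<inter> Y = {}}"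
  define F where "F = (\<lambda>(X, Y). (\<lambda>(x, y). {x, y}) ` (X \<times> Y) :: nat set set)"
  let ?b = "(real (c * n))\<^sup>2 / 2"
  have finQ: "finite Q" unfolding Q_def by (rule finite_subset[of _ "Pow ?V"]) auto
  have finp: "finite pairs" unfolding pairs_def by (rule finite_subset[of _ "Pow ?V \<times> Pow ?V"]) auto
  have cn: "2 \<le> c * n" using n c by (metis mult_le_mono mult_1_right)
  have "{0, 1} \<in> Q" using cn n c unfolding Q_def by auto
  then have Qne: "Q \<noteq> {}" by auto
  have "card Q = (c * n) choose 2" unfolding Q_def using n_subsets[of ?V 2] by simp
  then have "real (card Q) \<le> real (c * n * (c * n - 1)) / 2"
    unfolding choose_two using of_nat_div_le_of_nat[of "c * n * (c * n - 1)" 2, where 'a = real] by simp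
  also have "\<dots> \<le> real (c * n * (c * n)) / 2" by (intro divide_right_mono of_nat_mono mult_le_mono) auto
  finally have cQ: "real (card Q) \<le> ?b" by (simp add: power2_eq_square)
  have "real 2 * real 2 \<le> real c * real c" using c by (intro mult_mono) auto
  then have "2 \<le> real c * real c" by simp
  then have "(real n)\<^sup>2 * 2 \<le> (real n)\<^sup>2 * (real c * real c)" by (intro mult_left_mono) auto
  then have ab: "real (n * n) \<le> ?b" by (simp add: power2_eq_square algebra_simps)
  have FP: "p \<subseteq> Q \<and> n * n \<le> card p" if p: "p \<in> F ` pairs" for p
  proof -
    obtain X Y where XY: "X \<subseteq> ?V" "Y \<subseteq> ?V" "card X = n" "card Y = n" "X \<inter> Y = {}" "p = F (X, Y)"
      using p unfolding pairs_def by auto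
    have "inj_on (\<lambda>(x, y). {x, y}) (X \<times> Y)"
      unfolding inj_on_def using XY(5) by (auto simp: doubleton_eq_iff dest: disjoint_iff[THEN iffD1])
    then have "card p = n * n" using XY unfolding F_def by (simp add: card_image card_cartesian_product)
    moreover have "p \<subseteq> Q"
    proof
      fix e assume "e \<in> p"
      then obtain x y where e: "x \<in> X" "y \<in> Y" "e = {x, y}" using XY(6) unfolding F_def by auto
      then have "x \<noteq> y" using XY(5) by auto
      then show "e \<in> Q" using e XY(1,2) unfolding Q_def by auto
    qed
    ultimately show ?thesis by simp
  qed
  obtain S where S: "S \<subseteq> Q" "card S \<le> M"
    "real (card {p\<in>F ` pairs. p \<inter> S = {}}) \<le> real (card (F ` pairs)) * (1 - real (n * n) / ?b) ^ M"
    using greedy_cover[OF finite_imageI[OF finp] finQ Qne cQ ab FP] by blast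
  let ?u = "2 / (real c)\<^sup>2" and ?L = "ln (real c) + 1"
  have u: "real (n * n) / ?b = ?u" using n c by (simp add: power2_eq_square field_simps)
  have "?u \<le> 1"
    using ab cn unfolding u[symmetric] by (intro divide_le_eq_1[THEN iffD2]) auto
  then have u1: "0 \<le> 1 - ?u" by simp
  have "card (F ` pairs) \<le> card pairs" using finp by (rule card_image_le)
  also have "\<dots> \<le> card ({X. X \<subseteq> ?V \<and> card X = n} \<times> {X. X \<subseteq> ?V \<and> card X = n})"
    unfolding pairs_def by (intro card_mono finite_cartesian_product) (auto intro: finite_subset[of _ "Pow ?V"])
  also have "\<dots> = ((c * n) choose n) * ((c * n) choose n)" using n_subsets[of ?V n] by (simp add: card_cartesian_product)
  finally have "real (card (F ` pairs)) \<le> real ((c * n) choose n) * real ((c * n) choose n)"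
    by (metis of_nat_le_iff of_nat_mult)
  also have "\<dots> \<le> exp (real n * ?L) * exp (real n * ?L)"
    using binomial_le_exp[OF n, of c] c by (intro mult_mono) auto
  finally have cF: "real (card (F ` pairs)) \<le> exp (2 * real n * ?L)" by (simp add: exp_add[symmetric] algebra_simps)
  have "1 - ?u \<le> exp (- ?u)" using exp_ge_add_one_self[of "- ?u"] by simp
  then have "(1 - ?u) ^ M \<le> exp (- ?u) ^ M" using u1 by (intro power_mono) auto
  also have "\<dots> = exp (- (?u * real M))" by (simp add: exp_of_nat_mult[symmetric] mult.commute)
  finally have "real (card {p\<in>F ` pairs. p \<inter> S = {}}) \<le> exp (2 * real n * ?L) * exp (- (?u * real M))"
    using order_trans[OF S(3)[unfolded u] mult_mono[OF cF]] u1 by simp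
  also have "\<dots> = exp (2 * real n * ?L - ?u * real M)" by (simp add: exp_add[symmetric])
  also have "\<dots> < 1"
  proof -
    have "2 * ((real c)\<^sup>2 * real n * ?L) < 2 * real M" using M by simp
    then have "2 * real n * ?L < ?u * real M" using c by (simp add: field_simps)
    then show ?thesis by simp
  qed
  finally have "card {p\<in>F ` pairs. p \<inter> S = {}} = 0" by simp
  then have none: "{p\<in>F ` pairs. p \<inter> S = {}} = {}" using finp by simp
  have "joined (\<lambda>x y. {x, y} \<in> S) n ?V ?V"
    unfolding joined_def
  proof (intro allI impI)
    fix X Y assume "X \<subseteq> ?V" "Y \<subseteq> ?V" "card X = n" "card Y = n" "X \<inter> Y = {}"
    then have "F (X, Y) \<in> F ` pairs" unfolding pairs_def by auto
    then have "F (X, Y) \<inter> S \<noteq> {}" using none by blast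
    then show "\<exists>x\<in>X. \<exists>y\<in>Y. {x, y} \<in> S" unfolding F_def by auto
  qed
  moreover have "simple_graph S" 
    using S(1) finite_subset[OF S(1) finQ] unfolding simple_graph_def Q_def by auto
  ultimately show ?thesis using that S(2) by blast
qed

section \<open>Numerical estimates\<close>

lemma g_mult: "0 \<le> x \<Longrightarrow> 0 \<le> y \<Longrightarrow> g (x * y) = x * g y + y * g x"
  unfolding g_def by (auto simp: ln_mult algebra_simps)

text \<open>\<open>g\<close> is convex with derivative \<open>ln x + 1\<close>. Both bounds follow
  from \<open>ln z \<le> z - 1\<close>, at \<open>z = x / y\<close> and at
  \<open>z = y / x\<close>.\<close>

lemma g_diff_bounds:
  assumes "0 < x" "x \<le> y"
  shows "(y - x) * (ln x + 1) \<le> g y - g x" "g y - g x \<le> (y - x) * (ln y + 1)"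
proof -
  have y: "0 < y" using assms by simp
  have "ln (x / y) \<le> x / y - 1" using assms y by (intro ln_le_minus_one) simp
  then have "y * (ln x - ln y) \<le> y * (x / y - 1)" using assms y by (intro mult_left_mono) (auto simp: ln_div)
  also have "\<dots> = x - y" using y by (simp add: field_simps)
  finally show "(y - x) * (ln x + 1) \<le> g y - g x" using assms y unfolding g_def by (simp add: algebra_simps)
  have "ln (y / x) \<le> y / x - 1" using assms y by (intro ln_le_minus_one) simp
  then have "x * (ln y - ln x) \<le> x * (y / x - 1)" using assms y by (intro mult_left_mono) (auto simp: ln_div)
  also have "\<dots> = y - x" using assms by (simp add: field_simps)
  finally show "g y - g x \<le> (y - x) * (ln y + 1)" using assms y unfolding g_def by (simp add: algebra_simps)
qed

text \<open>At \<open>a = 1\<close> the terms in \<open>g d\<close> cancel and \<open>phi\<close>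
  becomes affine in \<open>d\<close>. Its constant term is at least
  \<open>2 * (ln (c - 2) + 1)\<close>, and the coefficient subtracted is at most
  \<open>ln c - ln (c - 3)\<close>, hence at most \<open>3 / (c - 3)\<close>.\<close>

lemma degree_lower_bound:
  assumes c: "c > 3" and d: "d \<ge> 0" and phi: "phi 1 c d \<le> 0"
  shows "2 * (c - 3) * (ln (c - 2) + 1) \<le> 3 * d"
proof -
  have "phi 1 c d = g c - g (c - 2) - d * (g (c - 3) + g c / 2 - 3 / 2 * g (c - 2))"
  proof -
    have e: "c - 1 - 1 = c - 2" "c - 2 - 1 = c - 3" "1 - 1 = (0::real)" by simp_all
    have gm: "g ((c - 2) * d) = (c - 2) * g d + d * g (c - 2)" "g ((c - 3) * d) = (c - 3) * g d + d * g (c - 3)"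
      "g (c * d) = c * g d + d * g c" using c d by (intro g_mult; simp)+
    show ?thesis unfolding phi_def e gm by (simp add: g_def[of 0]) (simp add: field_simps)
  qed
  then have 1: "g c - g (c - 2) \<le> d * (g (c - 3) + g c / 2 - 3 / 2 * g (c - 2))" using phi by simp
  have "2 * (ln (c - 2) + 1) \<le> g c - g (c - 2)" using g_diff_bounds(1)[of "c - 2" c] c by simp
  also note 1
  also have "g (c - 3) + g c / 2 - 3 / 2 * g (c - 2) \<le> ln c - ln (c - 3)"
    using g_diff_bounds(2)[of "c - 2" c] g_diff_bounds(1)[of "c - 3" "c - 2"] c by simp
  then have "d * (g (c - 3) + g c / 2 - 3 / 2 * g (c - 2)) \<le> d * (3 / (c - 3))"
  proof (intro mult_left_mono[OF _ d])
    assume le: "g (c - 3) + g c / 2 - 3 / 2 * g (c - 2) \<le> ln c - ln (c - 3)"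
    have "ln (c / (c - 3)) \<le> c / (c - 3) - 1" using c by (intro ln_le_minus_one) simp
    also have "\<dots> = 3 / (c - 3)" using c by (simp add: field_simps)
    finally show "g (c - 3) + g c / 2 - 3 / 2 * g (c - 2) \<le> 3 / (c - 3)" using le c by (simp add: ln_div)
  qed
  finally have "2 * (ln (c - 2) + 1) \<le> d * (3 / (c - 3))" .
  then show ?thesis using c by (simp add: field_simps)
qed

lemma edge_count_bound:
  fixes c d :: real and c' n :: nat
  assumes c: "c \<ge> 82" and d: "d \<ge> 0" "phi 1 c d \<le> 0" and c': "c' \<ge> 2" "real c' \<le> 53 / 100 * c" and n: "n \<ge> 1"
  shows "(real c')\<^sup>2 * real n * (ln (real c') + 1) + 1 \<le> c * real n * d / 2"
proof -
  define L where "L = ln (c - 2) + 1"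
  have L: "1 \<le> L" unfolding L_def using c by simp
  have "(real c')\<^sup>2 \<le> (53 / 100 * c)\<^sup>2" using c' by (intro power_mono) auto
  also have "\<dots> = 2809 / 10000 * (c * c)" by (simp add: power2_eq_square)
  finally have sq: "(real c')\<^sup>2 \<le> 2809 / 10000 * (c * c)" .
  have lnle: "ln (real c') + 1 \<le> L" unfolding L_def using c c' by simp
  have "(real c')\<^sup>2 * real n * (ln (real c') + 1) \<le> 2809 / 10000 * (c * c) * real n * L"
    using sq lnle c' by (intro mult_mono) (auto simp: add_nonneg_nonneg)
  \<comment> \<open>For \<open>c \<ge> 82\<close> the quadratic gap between \<open>1 / 3\<close> and
    \<open>0.53^2 = 0.2809\<close> outweighs the linear loss \<open>c\<close>. The 1 gained pays for
    rounding up the number of edges.\<close>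
  moreover have "82 * c \<le> c * c" using c by (intro mult_right_mono) auto
  then have "1 \<le> c * (c - 3) / 3 - 2809 / 10000 * (c * c)" 
  proof -
    have e: "c * (c - 3) / 3 - 2809 / 10000 * (c * c) = (1 / 3 - 2809 / 10000) * (c * c) - c" by (simp add: field_simps)
    moreover have "(1 / 3 - 2809 / 10000) * (82 * c) \<le> (1 / 3 - 2809 / 10000) * (c * c)"
      using \<open>82 * c \<le> c * c\<close> by (intro mult_left_mono) auto
    moreover have "1 \<le> (1 / 3 - 2809 / 10000) * (82 * c) - c" using c by simp
    ultimately show ?thesis unfolding e by linarith
  qed
  then have "1 * 1 * 1 \<le> (c * (c - 3) / 3 - 2809 / 10000 * (c * c)) * real n * L"
    using n L by (intro mult_mono) auto
  moreover have "c * real n * (2 * (c - 3) * L) \<le> c * real n * (3 * d)"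
    using degree_lower_bound[OF _ d] c unfolding L_def by (intro mult_left_mono) auto
  ultimately show ?thesis by (simp add: algebra_simps)
qed

lemma c_const_bounds:
  fixes t te :: nat
  assumes t: "t \<ge> 1" and te: "te \<le> t"
  shows "82 \<le> c_const t te" "real (odd_ratio (t - te) * 40 ^ te) \<le> 53 / 100 * c_const t te"
proof -
  let ?to = "t - te" and ?r = "odd_ratio (t - te) * 40 ^ te"
  have f: "82 \<le> f_const te ?to \<and> real ?r \<le> 53 / 100 * f_const te ?to"
  proof (cases "?to = 0")
    case True
    then obtain k where k: "te = Suc k" using t te by (cases te) auto
    \<comment> \<open>Without odd colours the exponent \<open>2 ^ 0 - 2\<close> is -1. At least one
      colour is then even, and 81 against 40 makes up for the division by 35.\<close>
    have f: "f_const te ?to = 82 / 35 * 81 * 81 ^ k"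
      unfolding True unfolding k f_const_def by (simp add: powr_minus)
    have "(1::real) \<le> 81 ^ k" "(40::real) ^ k \<le> 81 ^ k" by (auto intro: power_mono)
    moreover from this have "35 \<le> 81 * (81::real) ^ k" by linarith
    ultimately show ?thesis unfolding f unfolding True odd_ratio_def unfolding k by simp
  next
    case False
    have "(2::nat) ^ 1 \<le> 2 ^ ?to" using False by (intro power_increasing) auto
    then have "(2::real) ^ ?to - 2 = real (2 ^ ?to - 2)" by (simp add: of_nat_diff)
    then have f: "f_const te ?to = 82 * 35 ^ (2 ^ ?to - 2) * 81 ^ te"
      unfolding f_const_def by (simp only: powr_realpow zero_less_numeral)
    have "82 * 1 * 1 \<le> 82 * (35::real) ^ (2 ^ ?to - 2) * 81 ^ te" by (intro mult_mono) auto
    moreover have "(40::real) ^ te \<le> 81 ^ te" "(0::real) < 81 ^ te" by (auto intro: power_mono)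
    then have "50 * (40::real) ^ te \<le> 53 * 81 ^ te" by linarith
    ultimately show ?thesis unfolding f odd_ratio_def using False by simp
  qed
  \<comment> \<open>The worst case is two odd colours, \<open>41 * 35 ^ 2 = 50225\<close>, which is
    still below \<open>0.53 * 95412\<close>.\<close>
  have "real ?r \<le> 50225" if t2: "t = 2"
  proof -
    have "te = 0 \<or> te = 1 \<or> te = 2" using te t2 by linarith
    then show ?thesis using t2 by (auto simp: odd_ratio_def)
  qed
  then show "82 \<le> c_const t te" "real ?r \<le> 53 / 100 * c_const t te"
    using f unfolding c_const_def by (auto simp: min_def)
qed

section \<open>The Ramsey property\<close>

lemma has_mono_cycle_if_cyc:
  assumes "cyc (\<lambda>x y. {x, y} \<in> E \<and> col {x, y} = i) k"
  shows "has_mono_cycle E col i k"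
proof -
  obtain vs where vs: "length vs = k" "vs \<noteq> []" "distinct vs"
    "successively (\<lambda>x y. {x, y} \<in> E \<and> col {x, y} = i) vs"
    "{last vs, hd vs} \<in> E \<and> col {last vs, hd vs} = i"
    using assms unfolding cyc_def by auto
  have "{vs ! j, vs ! ((j + 1) mod k)} \<in> E \<and> col {vs ! j, vs ! ((j + 1) mod k)} = i" if j: "j < k" for j
  proof (cases "j + 1 < k")
    case True
    then show ?thesis using vs(1,4) by (simp add: successively_conv_nth)
  next
    case False
    then have "j + 1 = k" using j by simp
    then have "j = k - 1" "(j + 1) mod k = 0" by auto
    then show ?thesis using vs(1,2,5) by (simp add: last_conv_nth hd_conv_nth)
  qed
  then show ?thesis unfolding has_mono_cycle_def using vs(1,3) by blast
qed

text \<open>Removing the odd colours first leaves a pair of size \<open>40 ^ te * n\<close>;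
  removing the even ones inside it leaves a pair of size \<open>n\<close>. The host graph has an
  edge there, and the colour of that edge has been removed.\<close>

lemma joined_graph_arrows:
  fixes ns :: "nat list"
  assumes j: "joined (\<lambda>x y. {x, y} \<in> S) n {..<c * n} {..<c * n}" and n: "n \<ge> 1"
    and c: "c = odd_ratio (length ns - te) * 40 ^ te" and te: "card {i. i < length ns \<and> even (ns ! i)} = te"
    and K: "c * n \<le> 2 ^ K" and ns: "\<And>i. i < length ns \<Longrightarrow> 2 * K + 1 \<le> ns ! i \<and> ns ! i \<le> n"
    and col: "\<forall>e\<in>S. col e < length ns"
  shows "\<exists>i<length ns. has_mono_cycle S col i (ns ! i)"
proof (rule ccontr)
  assume no: "\<not> ?thesis"
  define E where "E i x y \<longleftrightarrow> {x, y} \<in> S \<and> col {x, y} = i" for i x y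
  have sy: "symp (E i)" for i unfolding E_def symp_def by (simp add: insert_commute)
  have nc: "\<not> cyc (E i) (ns ! i)" if "i < length ns" for i
  proof
    assume "cyc (E i) (ns ! i)"
    moreover have "E i = (\<lambda>x y. {x, y} \<in> S \<and> col {x, y} = i)" by (simp add: E_def fun_eq_iff)
    ultimately show False using has_mono_cycle_if_cyc[of S col i] no that by auto
  qed
  define qs where "qs = (\<lambda>P. map (\<lambda>i. (E i, ns ! i)) (filter (\<lambda>i. P (ns ! i)) [0..<length ns]))"
  have qs: "\<exists>i<length ns. F = E i \<and> l = ns ! i \<and> P l" if "(F, l) \<in> set (qs P)" for F l P
    using that unfolding qs_def by auto
  have len: "length (qs even) = te"
    unfolding qs_def length_map length_filter_conv_card using te by (simp add: conj_ac cong: conj_cong)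
  moreover have "length (qs even) + length (qs odd) = length ns"
    unfolding qs_def length_map using sum_length_filter_compl[of "\<lambda>i. even (ns ! i)" "[0..<length ns]"] by simp
  ultimately have len': "length (qs odd) = length ns - te" by simp
  have n40: "n \<le> 40 ^ te * n" by simp
  obtain X Y where XY: "X \<subseteq> {..<c * n}" "Y \<subseteq> {..<c * n}" "hole (qs odd) (40 ^ te * n) X Y"
  proof -
    have "\<exists>X Y. X \<subseteq> {..<c * n} \<and> Y \<subseteq> {..<c * n} \<and> hole (qs odd) (40 ^ te * n) X Y"
    proof (rule odd_colours_hole)
      show "symp F \<and> odd l \<and> 2 * K + 1 \<le> l \<and> l \<le> 40 ^ te * n \<and> \<not> cyc F l" if "(F, l) \<in> set (qs odd)" for F l
        using qs[OF that] sy nc ns n40 by (metis le_trans)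
      show "odd_ratio (length (qs odd)) * (40 ^ te * n) \<le> card {..<c * n}" unfolding len' c by simp
    qed (use K n in auto)
    then show ?thesis using that by blast
  qed
  have h: "X \<inter> Y = {}" "card X = 40 ^ te * n" "card Y = 40 ^ te * n" using XY(3) unfolding hole_def by auto
  obtain X' Y' where X': "X' \<subseteq> X" "Y' \<subseteq> Y" "hole (qs even) n X' Y'"
  proof -
    have "\<exists>X' Y'. X' \<subseteq> X \<and> Y' \<subseteq> Y \<and> hole (qs even) n X' Y'"
    proof (rule even_colours_hole)
      show "symp F \<and> even l \<and> 2 * K + 1 \<le> l \<and> l \<le> n \<and> \<not> cyc F l" if "(F, l) \<in> set (qs even)" for F l
        using qs[OF that] sy nc ns by metis
      show "finite X" "finite Y" using XY(1,2) finite_subset by blast+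
      show "card X \<le> 2 ^ K" using card_mono[OF _ XY(1)] K by simp
    qed (use h len n in auto)
    then show ?thesis using that by blast
  qed
  obtain x y where xy: "x \<in> X'" "y \<in> Y'" "{x, y} \<in> S"
  proof (rule joined_edge[OF j])
    show "X' \<subseteq> {..<c * n}" "Y' \<subseteq> {..<c * n}" using X' XY by auto
    show "n \<le> card X'" "n \<le> card Y'" "X' \<inter> Y' = {}" using X'(3) unfolding hole_def by auto
  qed
  let ?i = "col {x, y}"
  have i: "?i < length ns" using col xy by auto
  have E: "E ?i x y" unfolding E_def using xy by simp
  show False
  proof (cases "even (ns ! ?i)")
    case True
    then have "(E ?i, ns ! ?i) \<in> set (qs even)" using i unfolding qs_def by auto
    then show False using hole_no_edge[OF X'(3) _ xy(1,2)] E by blast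
  next
    case False
    then have "(E ?i, ns ! ?i) \<in> set (qs odd)" using i unfolding qs_def by auto
    then show False using hole_no_edge[OF XY(3), of _ _ x y] X'(1,2) xy(1,2) E by blast
  qed
qed

theorem theorem3p4:
  fixes t te :: nat and d :: nat
  assumes "t \<ge> 1" and "te \<le> t"
    and "\<forall>a::real. 0 \<le> a \<and> a \<le> 1 \<longrightarrow> phi a (c_const t te) (real d) \<le> 0"
  shows "\<exists>N0::real. \<forall>ns :: nat list.
    length ns = t \<longrightarrow> (\<forall>x\<in>set ns. x > 0) \<longrightarrow>
    card {i. i < t \<and> even (ns ! i)} = te \<longrightarrow>
    (let N = c_const t te * real (Max (set ns)) in
       N \<ge> N0 \<longrightarrow>
       (\<forall>i<t. real (ns ! i) \<ge> 2 * real_of_int \<lceil>log 2 N\<rceil> + 2) \<longrightarrow>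
       (\<exists>k::nat. N * real d = 2 * real k) \<longrightarrow>
       real (size_ramsey_cycles ns) \<le> N * real d / 2)"
\<comment> \<open>The estimates below hold for every \<open>N\<close>, so 0 serves as
  threshold.\<close>
proof (intro exI[of _ 0] allI impI, unfold Let_def, intro impI)
  fix ns :: "nat list"
  define n where "n = Max (set ns)"
  let ?c = "c_const t te"
  let ?N = "?c * real n"
  assume len: "length ns = t" and pos: "\<forall>x\<in>set ns. x > 0" and te: "card {i. i < t \<and> even (ns ! i)} = te"
    and long: "\<forall>i<t. real (ns ! i) \<ge> 2 * real_of_int \<lceil>log 2 (?c * real (Max (set ns)))\<rceil> + 2"
  have "set ns \<noteq> {}" using len assms(1) by auto
  then have n: "n \<ge> 1" unfolding n_def using pos Max_in[of "set ns"] by (simp add: Suc_le_eq)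
  have le_n: "ns ! i \<le> n" if "i < t" for i using that len unfolding n_def by simp
  define c where "c = odd_ratio (t - te) * 40 ^ te"
  have cb: "82 \<le> ?c" "real c \<le> 53 / 100 * ?c" unfolding c_def using c_const_bounds[OF assms(1,2)] by auto
  have "2 * 1 \<le> c" unfolding c_def using odd_ratio_ge by (intro mult_le_mono) auto
  then have c2: "2 \<le> c" by simp
  \<comment> \<open>\<open>2 ^ K\<close> bounds the \<open>c * n\<close> vertices of the host graph,
    and the assumption on the lengths becomes \<open>2 * K + 2 \<le> ns ! i\<close>.\<close>
  define K where "K = nat \<lceil>log 2 ?N\<rceil>"
  have "82 * 1 \<le> ?N" using cb(1) n by (intro mult_mono) auto
  then have N1: "1 \<le> ?N" by simp
  have logpos: "0 \<le> log 2 ?N" using N1 by simp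
  then have rK: "real K = real_of_int \<lceil>log 2 ?N\<rceil>" unfolding K_def by simp
  have "log 2 ?N \<le> real K" unfolding rK by simp
  then have "?N \<le> 2 powr real K" using N1 by (simp add: log_le_iff)
  moreover have "real c * real n \<le> ?N" using cb by (intro mult_right_mono) auto
  ultimately have "real (c * n) \<le> real (2 ^ K)" by (simp add: powr_realpow)
  then have K: "c * n \<le> 2 ^ K" by (simp only: of_nat_le_iff)
  let ?x = "(real c)\<^sup>2 * real n * (ln (real c) + 1)"
  \<comment> \<open>The greedy construction needs strictly more than \<open>?x\<close> steps;
    rounding costs at most one further edge, covered by \<open>edge_count_bound\<close>.\<close>
  define M where "M = nat \<lfloor>?x\<rfloor> + 1"
  have "0 \<le> ?x" using c2 by (intro mult_nonneg_nonneg add_nonneg_nonneg) auto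
  then have M: "?x < real M" "real M \<le> ?x + 1" unfolding M_def by linarith+
  obtain S where S: "simple_graph S" "card S \<le> M" "joined (\<lambda>x y. {x, y} \<in> S) n {..<c * n} {..<c * n}"
    using sparse_joined_graph[OF n c2 M(1)] by blast
  have "size_ramsey_cycles ns \<le> card S"
    unfolding size_ramsey_cycles_def
  proof (rule Least_le, intro exI[of _ S] conjI allI impI)
    fix col assume "\<forall>e\<in>S. col e < length ns"
    then show "\<exists>i<length ns. has_mono_cycle S col i (ns ! i)"
    proof (rule joined_graph_arrows[OF S(3) n _ _ K, rotated 3])
      show "c = odd_ratio (length ns - te) * 40 ^ te" unfolding c_def len ..
      show "card {i. i < length ns \<and> even (ns ! i)} = te" using te len by simp
      show "2 * K + 1 \<le> ns ! i \<and> ns ! i \<le> n" if i: "i < length ns" for i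
      proof -
        have "2 * real K + 2 \<le> real (ns ! i)" 
          using long[rule_format, of i] i len unfolding rK n_def by simp
        then have "2 * K + 1 \<le> ns ! i" by linarith
        then show ?thesis using le_n[of i] i len by blast
      qed
    qed
  qed (use S in auto)
  then have "real (size_ramsey_cycles ns) \<le> ?x + 1" using S(2) M(2) by linarith
  also have "\<dots> \<le> ?c * real n * real d / 2"
    using edge_count_bound[OF cb(1) _ _ c2 cb(2) n, of "real d"] assms(3) by simp
  finally show "real (size_ramsey_cycles ns) \<le> ?c * real (Max (set ns)) * real d / 2" unfolding n_def .
qed

end
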